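(* There exists a constant $c>0$ such that for every sufficiently large prime $p$ and every integer $s$ for which $t=(p-3s+1)/2$ is a positive integer satisfying $t\le c\cdot p$, the following holds: the symmetric complete sum-free subsets of $\mathbb{Z}_p$ of size $s$ are precisely all the dilations of the sets $S_T\subseteq\mathbb{Z}_p$ for $t$-special sets $T\subseteq[0,2t-1]$.
   Context: $\mathbb{Z}_p$ is the cyclic group of integers modulo $p$. For subsets $A,B$ of an abelian additive group $G$, $A+B=\{x+y \mid x\in A, y\in B\}$, $-A=\{-x \mid x\in A\}$, and $\pm A=A\cup(-A)$. A set $S\subseteq G$ is symmetric if $S=-S$, complete if every $z\in G\setminus S$ satisfies $z\in S+S$, and sum-free if $S\cap(S+S)=\emptyset$. A dilation of $A\subseteq\mathbb{Z}_p$ is a set $d\cdot A=\{da \mid a\in A\}$ with $d\in\mathbb{Z}_p\setminus\{0\}$. For integers $a\le b$, $[a,b]=\{z\in\mathbb{Z} \mid a\le z\le b\}$; the same notation is used for the subset of $\mathbb{Z}_n$ represented by these integers. Definition of $S_T$: let $n$ and $s$ be integers for which $t=(n-3s+1)/2$ is a positive integer and $n\le 4s-3$. For a set of integers $T\subseteq[0,2t-1]$, $S_T\subseteq\mathbb{Z}_n$ is the set $S_T=[n-2s+1,2s-1]\cup\pm(s+T)$ (taken modulo $n$), where $s+T=\{s+x \mid x\in T\}$. In the claim, $n=p$. For an integer $t\ge 1$, a set of integers $T\subseteq[0,2t-1]$ is called $t$-special if (i) $|T|=t$, (ii) $2t-1\notin T+T+T$, and (iii) $[0,2t-1+\min(T)]\setminus(2t-1-T)\subseteq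 T+T$, where $2t-1-T=\{2t-1-x \mid x\in T\}$, $\min(T)$ is the smallest integer in $T$, and all additions are over the integers. *)

theory Defs
  imports
    "HOL-Number_Theory.Residues"
    "HOL-Library.Set_Algebras"
begin

text \<open>
  An abelian additive group is modelled by the additive part of a ring record \<open>G\<close>, with the
  set operations \<open>set_add\<close> (written \<open><+>\<close>) and \<open>a_set_inv\<close> from HOL-Algebra.
  The cyclic group of integers modulo \<open>n\<close> is \<open>residue_ring n\<close>; its elements are the integers
  in \<open>{0..n - 1}\<close>.
\<close>

definition symmetric_set :: "('a, 'b) ring_scheme \<Rightarrow> 'a set \<Rightarrow> bool" where
  "symmetric_set G S \<longleftrightarrow> S = a_set_inv\<^bsub>G\<^esub> S"

definition complete_set :: "('a, 'b) ring_scheme \<Rightarrow> 'a set \<Rightarrow> bool" where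
  "complete_set G S \<longleftrightarrow> (\<forall>z \<in> carrier G - S. z \<in> S <+>\<^bsub>G\<^esub> S)"

definition sum_free :: "('a, 'b) ring_scheme \<Rightarrow> 'a set \<Rightarrow> bool" where
  "sum_free G S \<longleftrightarrow> S \<inter> (S <+>\<^bsub>G\<^esub> S) = {}"

definition plus_minus :: "('a, 'b) ring_scheme \<Rightarrow> 'a set \<Rightarrow> 'a set" where
  "plus_minus G A = A \<union> a_set_inv\<^bsub>G\<^esub> A"

definition dilation :: "('a, 'b) ring_scheme \<Rightarrow> 'a \<Rightarrow> 'a set \<Rightarrow> 'a set" where
  "dilation R d A = (\<lambda>a. d \<otimes>\<^bsub>R\<^esub> a) ` A"

definition residues_of :: "int \<Rightarrow> int set \<Rightarrow> int set" where
  "residues_of n X = (\<lambda>x. x mod n) ` X"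

text \<open>
  The set \<open>S\<^sub>T\<close> as a subset of the integers modulo \<open>n\<close>. It is meant to be used when
  \<open>t = (n - 3 * s + 1) / 2\<close> is a positive integer, \<open>n \<le> 4 * s - 3\<close> and \<open>T \<subseteq> {0..2 * t - 1}\<close>.
\<close>

definition S_set :: "int \<Rightarrow> int \<Rightarrow> int set \<Rightarrow> int set" where
  "S_set n s T =
     residues_of n {n - 2 * s + 1 .. 2 * s - 1}
     \<union> plus_minus (residue_ring n) (residues_of n ((\<lambda>x. s + x) ` T))"

text \<open>
  All sumsets here are sumsets of integers: \<open>+\<close> on sets is the operation of
  \<open>HOL-Library.Set_Algebras\<close>. For \<open>t \<ge> 1\<close> the cardinality condition makes \<open>T\<close> nonempty, so that
  \<open>Min T\<close> is its smallest element.
\<close>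

definition special :: "int \<Rightarrow> int set \<Rightarrow> bool" where
  "special t T \<longleftrightarrow>
     T \<subseteq> {0 .. 2 * t - 1} \<and>
     int (card T) = t \<and>
     2 * t - 1 \<notin> T + T + T \<and>
     {0 .. 2 * t - 1 + Min T} - (\<lambda>x. 2 * t - 1 - x) ` T \<subseteq> T + T"

end

theory Submission
  imports Defs
begin

text \<open>
A subset of \<open>\<int>\<^sub>p\<close> is handled as a \<open>p\<close>-periodic set of integers \<open>X\<close>, of size \<open>\<mu> X\<close> (its number of
residues); sumsets then are sumsets of integers, and dilations are preimages under multiplication.

The heart of the matter is a structure statement: a sum-free set \<open>S\<close> with
\<open>p = 3 * \<mu> S + 2 * t - 1\<close> and \<open>t\<close> tiny compared with \<open>p\<close> has a dilate that avoids the interval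
\<open>[-p/4, p/4]\<close> (\<open>exists_dilation_avoiding_middle\<close>). Sum-freeness gives
\<open>\<mu> (S + S) \<le> p - \<mu> S = 2 * \<mu> S + 2 * t - 1\<close>, almost the Cauchy-Davenport minimum, but \<open>S\<close> is far too
dense for the usual rectification arguments. The proof therefore studies the almost-periods of \<open>S\<close>,
the translations \<open>x\<close> for which \<open>\<mu> S - \<mu> (S \<inter> (S + x)) \<le> k\<close>. They form a family \<open>N\<^sub>k\<close> with
\<open>N\<^sub>i + N\<^sub>j \<subseteq> N\<^bsub>i+j\<^esub>\<close>, and \<open>N\<^sub>k\<close> misses \<open>S\<close> as long as \<open>k < \<mu> S\<close>, because an element of \<open>S\<close> moves \<open>S\<close>
off itself. If \<open>S\<close> is an interval of length about \<open>p/3\<close>, then \<open>N\<^sub>k\<close> is the interval \<open>[-k, k]\<close>; the aim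
is to see this, up to dilation and small errors, for one value of \<open>k\<close> that is a small multiple
of \<open>p\<close>.

\<^item> The size of \<open>N\<^sub>k\<close> is right. The excess \<open>\<mu> (A + S) - \<mu> A - \<mu> S + 1\<close> at most doubles when \<open>A\<close> is
  replaced by \<open>A \<inter> (A + x)\<close>, by submodularity and Cauchy-Davenport
  (\<open>plus_Int_translate_excess\<close>). Starting from \<open>A = S\<close>, boundedly many such steps lead to a set \<open>A\<close> of
  size a small multiple of \<open>p\<close> with negligible excess. All differences of \<open>A\<close> lie in \<open>N\<^sub>k\<close> for
  \<open>k = \<mu> (A + S) - \<mu> S \<approx> \<mu> A\<close>, so \<open>N\<^sub>k\<close> has about \<open>2 * k\<close> elements at least. On the other hand
  Cauchy-Davenport, applied along \<open>h\<close> summands with \<open>h * 2 * k < \<mu> S\<close>, bounds the size of \<open>N\<^bsub>2k\<^esub>\<close> by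
  about \<open>4 * k\<close>.

\<^item> Some nontrivial character is close to \<open>1\<close> on most of \<open>N\<^sub>k\<close>. This is an average over the characters,
  weighted by the squared Fourier coefficients of \<open>S\<close> (\<open>exists_flat_character\<close>). After a dilation,
  most of \<open>N\<^sub>k\<close> lies in \<open>[-p/6, p/6]\<close>, where sums of two elements can be computed in \<open>\<int>\<close>.

\<^item> A symmetric set of integers \<open>C\<close> whose sumset has about \<open>2 * card C\<close> elements nearly fills a symmetric
  arithmetic progression around \<open>0\<close> (\<open>symmetric_small_doubling\<close>). After a second dilation, \<open>N\<^bsub>2k\<^esub>\<close>
  contains an interval of almost the expected length, and its multiples \<open>N\<^bsub>2hk\<^esub>\<close>, which still miss \<open>S\<close>,
  contain \<open>[-p/4, p/4]\<close>.

The rest is exact and elementary. A symmetric sum-free set of size \<open>s\<close> avoiding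
\<open>[-p/4, p/4]\<close> lies in \<open>[s, p - s]\<close> (\<open>sum_free_subset_interval\<close>). There, sums of two elements never fall into the middle
part \<open>[s + 2 * t, 2 * s - 1]\<close>, so completeness puts all of that part into the set, and what is left is a set
\<open>s + T\<close> and its mirror image. The conditions of \<^const>\<open>special\<close> say exactly that this set has the right
size, is sum-free and is complete.
\<close>

section \<open>Subsets of a cyclic group as periodic sets of integers\<close>

locale modulus =
  fixes p :: int
  assumes p_gt_1: "p > 1"
begin

definition periodic :: "int set \<Rightarrow> bool" where
  "periodic X \<longleftrightarrow> (\<forall>x y. [x = y] (mod p) \<longrightarrow> x \<in> X \<longrightarrow> y \<in> X)"

definition \<mu> :: "int set \<Rightarrow> int" where
  "\<mu> X = int (card (X \<inter> {0..<p}))"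

lemma periodicD: "periodic X \<Longrightarrow> [x = y] (mod p) \<Longrightarrow> x \<in> X \<longleftrightarrow> y \<in> X"
  unfolding periodic_def by (meson cong_sym)

lemma periodic_mod: "periodic X \<Longrightarrow> x mod p \<in> X \<longleftrightarrow> x \<in> X"
  by (rule periodicD) simp_all

lemma periodicI: "(\<And>x y. [x = y] (mod p) \<Longrightarrow> x \<in> X \<Longrightarrow> y \<in> X) \<Longrightarrow> periodic X"
  unfolding periodic_def by blast

lemma periodic_Un [intro]: "periodic X \<Longrightarrow> periodic Y \<Longrightarrow> periodic (X \<union> Y)"
  unfolding periodic_def by blast

lemma periodic_Int [intro]: "periodic X \<Longrightarrow> periodic Y \<Longrightarrow> periodic (X \<inter> Y)"
  unfolding periodic_def by blast

lemma periodic_translate [intro]: "periodic X \<Longrightarrow> periodic {y. y - a \<in> X}"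
  by (intro periodicI) (simp, meson cong_diff cong_refl periodicD)

lemma periodic_affine: "periodic X \<Longrightarrow> periodic {y. e * y \<in> X}"
  by (intro periodicI) (simp, meson cong_mult cong_refl periodicD)

lemma periodic_plus [intro]:
  assumes "periodic X" shows "periodic (X + Y)"
proof (rule periodicI)
  fix x y assume c: "[x = y] (mod p)" and "x \<in> X + Y"
  then obtain a b where ab: "a \<in> X" "b \<in> Y" "x = a + b" by (auto elim: set_plus_elim)
  have "[a = y - b] (mod p)" using c ab(3) by (metis add_diff_cancel_right' cong_diff cong_refl)
  with ab assms have "y - b \<in> X" using periodicD by blast
  then have "(y - b) + b \<in> X + Y" using ab(2) by (rule set_plus_intro)
  then show "y \<in> X + Y" by simp
qed

lemma mu_nonneg: "\<mu> X \<ge> 0" by (simp add: \<mu>_def)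

lemma mu_mono: "X \<subseteq> Y \<Longrightarrow> \<mu> X \<le> \<mu> Y"
  unfolding \<mu>_def by (intro of_nat_mono card_mono) auto

lemma mu_UNIV: "\<mu> UNIV = p"
  unfolding \<mu>_def using p_gt_1 by simp

lemma mu_le: "\<mu> X \<le> p"
  using mu_mono[of X UNIV] mu_UNIV by simp

lemma mu_Un_Int: "\<mu> (X \<union> Y) + \<mu> (X \<inter> Y) = \<mu> X + \<mu> Y"
proof -
  have "card (X \<inter> {0..<p}) + card (Y \<inter> {0..<p}) =
     card ((X \<inter> {0..<p}) \<union> (Y \<inter> {0..<p})) + card ((X \<inter> {0..<p}) \<inter> (Y \<inter> {0..<p}))"
    by (rule card_Un_Int) auto
  moreover have "(X \<inter> {0..<p}) \<union> (Y \<inter> {0..<p}) = (X \<union> Y) \<inter> {0..<p}"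
    "(X \<inter> {0..<p}) \<inter> (Y \<inter> {0..<p}) = (X \<inter> Y) \<inter> {0..<p}" by auto
  ultimately show ?thesis unfolding \<mu>_def by simp
qed

text \<open>
The maps \<open>f\<close> and \<open>f'\<close> are inverse to each other modulo \<open>p\<close>; translations, reflections and dilations are
the cases of interest.
\<close>

lemma mu_bij:
  assumes "periodic X" "\<And>x. f' (f x) mod p = x mod p" "\<And>x. f (f' x) mod p = x mod p"
    and cf: "\<And>x y. [x = y] (mod p) \<Longrightarrow> [f x = f y] (mod p)"
    and cf': "\<And>x y. [x = y] (mod p) \<Longrightarrow> [f' x = f' y] (mod p)"
  shows "\<mu> {y. f y \<in> X} = \<mu> X"
proof -
  have "bij_betw (\<lambda>x. f x mod p) ({y. f y \<in> X} \<inter> {0..<p}) (X \<inter> {0..<p})"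
  proof (rule bij_betw_byWitness[where f' = "\<lambda>x. f' x mod p"])
    show "\<forall>a\<in>{y. f y \<in> X} \<inter> {0..<p}. f' (f a mod p) mod p = a"
      using assms(2) cf' by (metis IntD2 atLeastLessThan_iff cong_def cong_mod_left mod_pos_pos_trivial cong_refl)
    show "\<forall>a\<in>X \<inter> {0..<p}. f (f' a mod p) mod p = a"
      using assms(3) cf by (metis IntD2 atLeastLessThan_iff cong_def cong_mod_left mod_pos_pos_trivial cong_refl)
    show "(\<lambda>x. f x mod p) ` ({y. f y \<in> X} \<inter> {0..<p}) \<subseteq> X \<inter> {0..<p}"
      using p_gt_1 periodic_mod[OF assms(1)] by auto
    have "f (f' x mod p) \<in> X" if "x \<in> X" for x
    proof -
      have "[f (f' x mod p) = f (f' x)] (mod p)" by (rule cf) simp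
      then have "[f (f' x mod p) = x] (mod p)" using assms(3)[of x] by (simp add: cong_def)
      then show ?thesis using that periodicD[OF assms(1)] by blast
    qed
    then show "(\<lambda>x. f' x mod p) ` (X \<inter> {0..<p}) \<subseteq> {y. f y \<in> X} \<inter> {0..<p}"
      using p_gt_1 by auto
  qed
  then show ?thesis unfolding \<mu>_def using bij_betw_same_card by fastforce
qed

lemma mu_translate: "periodic X \<Longrightarrow> \<mu> {y. y - a \<in> X} = \<mu> X"
  by (rule mu_bij[where f' = "\<lambda>x. x + a"]) (auto intro: cong_add cong_diff)

lemma mu_uminus: "periodic X \<Longrightarrow> \<mu> {y. - y \<in> X} = \<mu> X"
  by (rule mu_bij[where f' = uminus]) (auto simp: cong_minus_minus_iff)

lemma mu_pos:
  assumes "periodic X" "x \<in> X" shows "\<mu> X \<ge> 1"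
proof -
  have "x mod p \<in> X \<inter> {0..<p}" using periodic_mod[OF assms(1)] assms(2) p_gt_1 by auto
  then have "card (X \<inter> {0..<p}) > 0" by (subst card_gt_0_iff) blast
  then show ?thesis unfolding \<mu>_def by simp
qed

lemma mu_ge_card:
  assumes "periodic X" "C \<subseteq> X" "\<And>x y. x \<in> C \<Longrightarrow> y \<in> C \<Longrightarrow> [x = y] (mod p) \<Longrightarrow> x = y"
  shows "int (card C) \<le> \<mu> X"
proof -
  have "inj_on (\<lambda>x. x mod p) C" using assms(3) by (auto simp: inj_on_def cong_def)
  moreover have "(\<lambda>x. x mod p) ` C \<subseteq> X \<inter> {0..<p}"
    using assms(1,2) periodic_mod p_gt_1 by auto
  ultimately have "card C \<le> card (X \<inter> {0..<p})" by (intro card_inj_on_le) auto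
  then show ?thesis unfolding \<mu>_def by simp
qed

end

locale prime_modulus = modulus +
  assumes prime_p: "prime p"
begin

lemma inverse_mod_p:
  assumes "\<not> p dvd e"
  obtains e' where "[e * e' = 1] (mod p)" "\<not> p dvd e'"
proof -
  have "coprime e p" using assms prime_p by (meson coprime_commute prime_imp_coprime)
  then obtain e' where e': "[e * e' = 1] (mod p)" by (meson cong_solve_coprime_int)
  have "\<not> p dvd e'"
  proof
    assume "p dvd e'"
    then have "p dvd e * e'" by simp
    then have "p dvd 1" using e' by (metis cong_dvd_iff)
    then show False using p_gt_1 by simp
  qed
  with e' that show thesis by blast
qed

lemma mu_dilate:
  assumes "periodic X" "\<not> p dvd e"
  shows "\<mu> {y. e * y \<in> X} = \<mu> X"
proof -
  obtain e' where e': "[e * e' = 1] (mod p)" using inverse_mod_p assms(2) by blast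
  have 1: "[e' * (e * x) = x] (mod p)" "[e * (e' * x) = x] (mod p)" for x
    using cong_mult[OF e' cong_refl[of x]] by (simp_all add: ac_simps)
  show ?thesis
    by (rule mu_bij[where f' = "\<lambda>x. e' * x"])
       (use assms 1 in \<open>auto simp: cong_def[symmetric] intro: cong_mult\<close>)
qed

text \<open>
The multiples of \<open>h\<close> run through all residues, since \<open>h\<close> is invertible modulo the prime \<open>p\<close>.
\<close>

lemma closed_under_step_UNIV:
  assumes "periodic X" "X \<noteq> {}" "\<not> p dvd h" "\<And>x. x \<in> X \<Longrightarrow> x + h \<in> X"
  shows "X = UNIV"
proof -
  obtain a where a: "a \<in> X" using assms(2) by blast
  have step: "a + int n * h \<in> X" for n
  proof (induction n)
    case (Suc n) then show ?case using assms(4)[of "a + int n * h"] by (simp add: algebra_simps)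
  qed (use a in simp)
  have "y \<in> X" for y
  proof -
    obtain h' where h': "[h * h' = 1] (mod p)" using inverse_mod_p assms(3) by blast
    define n where "n = nat ((h' * (y - a)) mod p)"
    have n: "int n = (h' * (y - a)) mod p" unfolding n_def using p_gt_1 by simp
    have "[int n * h = (h' * (y - a)) * h] (mod p)" unfolding n by (intro cong_mult) auto
    also have "(h' * (y - a)) * h = (h * h') * (y - a)" by (simp add: ac_simps)
    also have "[(h * h') * (y - a) = 1 * (y - a)] (mod p)" using h' by (intro cong_mult) auto
    finally have "[a + int n * h = a + (y - a)] (mod p)" by (intro cong_add) auto
    then show ?thesis using step[of n] periodicD[OF assms(1)] by auto
  qed
  then show ?thesis by blast
qed

text \<open>
Induction on the size of \<open>B\<close>. If \<open>B\<close> has two residues and \<open>A\<close> is not everything, some translate of \<open>B\<close>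
meets \<open>A\<close> without being contained in it. Dyson's transform with that translate moves the elements of the
translate outside \<open>A\<close> from \<open>B\<close> to \<open>A\<close>: the sum of the sizes stays the same, the sumset does not grow,
and \<open>B\<close> becomes smaller without becoming empty.
\<close>

theorem Cauchy_Davenport:
  assumes "periodic A" "A \<noteq> {}" "periodic B" "B \<noteq> {}"
  shows "A + B = UNIV \<or> \<mu> (A + B) \<ge> \<mu> A + \<mu> B - 1"
  using assms
proof (induction "nat (\<mu> B)" arbitrary: A B rule: less_induct)
  case less
  note A = less.prems(1,2) and B = less.prems(3,4)
  obtain b1 where b1: "b1 \<in> B" using B by blast
  show ?case
  proof (cases "\<exists>b2\<in>B. \<not> p dvd (b2 - b1)")
    case False
    have "\<mu> A = \<mu> {y. y - b1 \<in> A}" using mu_translate A by simp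
    also have "\<dots> \<le> \<mu> (A + B)"
    proof (intro mu_mono subsetI)
      fix y assume "y \<in> {y. y - b1 \<in> A}"
      then have "(y - b1) + b1 \<in> A + B" using b1 by (intro set_plus_intro) auto
      then show "y \<in> A + B" by simp
    qed
    finally have 1: "\<mu> A \<le> \<mu> (A + B)" .
    have "B \<inter> {0..<p} \<subseteq> {b1 mod p}"
    proof
      fix b assume b: "b \<in> B \<inter> {0..<p}"
      then have "p dvd (b - b1)" using False by blast
      then have "b mod p = b1 mod p" by (simp add: mod_eq_dvd_iff)
      then show "b \<in> {b1 mod p}" using b by simp
    qed
    then have "card (B \<inter> {0..<p}) \<le> card {b1 mod p}" by (intro card_mono) auto
    then have "\<mu> B \<le> 1" unfolding \<mu>_def by simp
    with 1 show ?thesis by simp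
  next
    case True
    then obtain b2 where b2: "b2 \<in> B" "\<not> p dvd (b2 - b1)" by blast
    show ?thesis
    proof (cases "A = UNIV")
      case True
      have "y \<in> A + B" for y using set_plus_intro[of "y - b1" A b1 B] b1 True by simp
      then show ?thesis by blast
    next
      case False
      then obtain a where a: "a \<in> A" "a + (b2 - b1) \<notin> A"
        using closed_under_step_UNIV[OF A b2(2)] by blast
      \<comment> \<open>With this \<open>e\<close>, the translate \<open>B + e\<close> meets \<open>A\<close> in \<open>a\<close>, but \<open>b2 + e\<close> is not in \<open>A\<close>.\<close>
      define e where "e = a - b1"
      define B' where "B' = B \<inter> {b. b - (- e) \<in> A}"
      define A' where "A' = A \<union> {y. y - e \<in> B}"
      have pB': "periodic B'" unfolding B'_def using A B by blast
      have pA': "periodic A'" unfolding A'_def using A B by blast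
      have b1': "b1 \<in> B'" unfolding B'_def e_def using a b1 by simp
      have b2': "b2 \<notin> B'" unfolding B'_def e_def using a by (simp add: algebra_simps)
      have "b2 mod p \<in> B \<inter> {0..<p}" "b2 mod p \<notin> B' \<inter> {0..<p}"
        using b2 b2' B pB' periodic_mod p_gt_1 by auto
      moreover have "B' \<inter> {0..<p} \<subseteq> B \<inter> {0..<p}" unfolding B'_def by blast
      ultimately have "B' \<inter> {0..<p} \<subset> B \<inter> {0..<p}" by blast
      then have "card (B' \<inter> {0..<p}) < card (B \<inter> {0..<p})" by (intro psubset_card_mono) auto
      then have lt: "nat (\<mu> B') < nat (\<mu> B)" unfolding \<mu>_def by simp
      have IH: "A' + B' = UNIV \<or> \<mu> (A' + B') \<ge> \<mu> A' + \<mu> B' - 1"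
        by (rule less.hyps[OF lt pA' _ pB']) (use A b1' in \<open>auto simp: A'_def\<close>)
      have "A' + B' \<subseteq> A + B"
      proof
        fix x assume "x \<in> A' + B'"
        then obtain u v where uv: "u \<in> A'" "v \<in> B'" "x = u + v" by (auto elim: set_plus_elim)
        show "x \<in> A + B"
        proof (cases "u \<in> A")
          case True then show ?thesis using uv unfolding B'_def by (auto intro: set_plus_intro)
        next
          case False
          then have "u - e \<in> B" "v + e \<in> A" using uv unfolding A'_def B'_def by auto
          then have "(v + e) + (u - e) \<in> A + B" by (intro set_plus_intro)
          then show ?thesis using uv by (simp add: algebra_simps)
        qed
      qed
      moreover have "\<mu> A' + \<mu> B' = \<mu> A + \<mu> B"
      proof -
        have "\<mu> B' = \<mu> {y. y - e \<in> B'}" using mu_translate[OF pB'] by simp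
        also have "{y. y - e \<in> B'} = A \<inter> {y. y - e \<in> B}" unfolding B'_def by auto
        finally have "\<mu> A' + \<mu> B' = \<mu> A + \<mu> {y. y - e \<in> B}"
          unfolding A'_def using mu_Un_Int[of A "{y. y - e \<in> B}"] by simp
        then show ?thesis using mu_translate[OF B(1)] by simp
      qed
      ultimately show ?thesis using IH mu_mono[of "A' + B'" "A + B"] by auto
    qed
  qed
qed

end

section \<open>Translates, overlaps and the submodular excess of a sumset\<close>

context modulus begin

definition overlap :: "int set \<Rightarrow> int \<Rightarrow> int" where
  "overlap X x = \<mu> (X \<inter> {y. y - x \<in> X})"

lemma overlap_0: "overlap X 0 = \<mu> X"
  unfolding overlap_def by simp

lemma overlap_cong:
  assumes "periodic X" "[x = y] (mod p)" shows "overlap X x = overlap X y"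
proof -
  have "z - x \<in> X \<longleftrightarrow> z - y \<in> X" for z
    using assms by (meson cong_diff cong_refl periodicD)
  then show ?thesis unfolding overlap_def by simp
qed

lemma overlap_uminus:
  assumes "periodic X" shows "overlap X (- x) = overlap X x"
proof -
  have "overlap X x = \<mu> {y. y - (- x) \<in> X \<inter> {y. y - x \<in> X}}"
    unfolding overlap_def by (rule mu_translate[symmetric]) (use assms in auto)
  also have "{y. y - (- x) \<in> X \<inter> {y. y - x \<in> X}} = X \<inter> {y. y - (- x) \<in> X}" by auto
  finally show ?thesis unfolding overlap_def by simp
qed

text \<open>
The number \<open>\<mu> X - overlap X x\<close> of elements that leave \<open>X\<close> under translation by \<open>x\<close> is subadditive
in \<open>x\<close>.
\<close>

lemma overlap_add:
  assumes "periodic X"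
  shows "overlap X (x + y) \<ge> overlap X x + overlap X y - \<mu> X"
proof -
  let ?Y = "{z. z - x \<in> X}" and ?Z = "{z. z - (x + y) \<in> X}"
  have "{z. z - x \<in> X \<inter> {z. z - y \<in> X}} = ?Y \<inter> ?Z" by (auto simp: algebra_simps)
  then have y: "\<mu> (?Y \<inter> ?Z) = overlap X y"
    unfolding overlap_def using mu_translate[of "X \<inter> {z. z - y \<in> X}" x] assms by auto
  have "\<mu> ((X \<inter> ?Y) \<union> (?Y \<inter> ?Z)) \<le> \<mu> ?Y" by (rule mu_mono) blast
  also have "\<mu> ?Y = \<mu> X" by (rule mu_translate[OF assms])
  finally have 1: "\<mu> ((X \<inter> ?Y) \<union> (?Y \<inter> ?Z)) \<le> \<mu> X" .
  have "\<mu> ((X \<inter> ?Y) \<inter> (?Y \<inter> ?Z)) \<le> overlap X (x + y)"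
    unfolding overlap_def by (rule mu_mono) blast
  with 1 y mu_Un_Int[of "X \<inter> ?Y" "?Y \<inter> ?Z"] show ?thesis unfolding overlap_def[of X x] by linarith
qed

lemma sum_overlap:
  assumes "periodic X" shows "(\<Sum>x\<in>{0..<p}. overlap X x) = (\<mu> X)\<^sup>2"
proof -
  have overlap_eq: "overlap X x = (\<Sum>y\<in>X \<inter> {0..<p}. if y - x \<in> X then 1 else 0)" for x
  proof -
    have "X \<inter> {y. y - x \<in> X} \<inter> {0..<p} = {y \<in> X \<inter> {0..<p}. y - x \<in> X}" by blast
    then show ?thesis unfolding overlap_def \<mu>_def by (simp add: sum.If_cases Int_def)
  qed
  have "(\<Sum>x\<in>{0..<p}. overlap X x)
      = (\<Sum>y\<in>X \<inter> {0..<p}. \<Sum>x\<in>{0..<p}. if y - x \<in> X then 1 else 0)"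
    unfolding overlap_eq by (rule sum.swap)
  also have "\<dots> = (\<Sum>y\<in>X \<inter> {0..<p}. \<mu> X)"
  proof (rule sum.cong)
    fix y
    have "\<mu> {x. y - x \<in> X} = \<mu> X"
      by (rule mu_bij[where f' = "\<lambda>x. y - x"]) (use assms in \<open>auto intro: cong_diff\<close>)
    then show "(\<Sum>x\<in>{0..<p}. if y - x \<in> X then 1 else 0) = \<mu> X"
      unfolding \<mu>_def by (simp add: sum.If_cases Int_commute)
  qed simp
  also have "\<dots> = (\<mu> X)\<^sup>2" unfolding \<mu>_def by (simp add: power2_eq_square)
  finally show ?thesis .
qed

end

context prime_modulus begin

text \<open>
The translations with overlap above three quarters cannot be closed under addition of a nonzero one of
them, since they would then be all translations and the average overlap would be too large. The first
step out of this set still leaves half of \<open>X\<close>. If there is no nonzero such translation at all, the average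
over the nonzero translations supplies a translation that is not too small.
\<close>

lemma exists_moderate_overlap:
  assumes X: "periodic X" and two: "\<mu> X \<ge> 2" and half: "2 * \<mu> X \<le> p"
  obtains x where "4 * overlap X x \<le> 3 * \<mu> X" "\<mu> X * (\<mu> X - 1) \<le> p * overlap X x"
proof -
  let ?m = "\<mu> X"
  define Y where "Y = {x. 4 * overlap X x > 3 * ?m}"
  have pY: "periodic Y" unfolding Y_def
    by (rule periodicI) (use overlap_cong[OF X] in auto)
  have Y0: "0 \<in> Y" unfolding Y_def using overlap_0 two by simp
  show thesis
  proof (cases "\<exists>x\<in>Y. \<not> p dvd x")
    case True
    then obtain x where x: "x \<in> Y" "\<not> p dvd x" by blast
    have "Y \<noteq> UNIV"
    proof
      assume "Y = UNIV"
      then have "3 * ?m < 4 * overlap X x" for x unfolding Y_def by blast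
      then have "(\<Sum>x\<in>{0..<p}. 3 * ?m) \<le> (\<Sum>x\<in>{0..<p}. 4 * overlap X x)"
        by (intro sum_mono) (simp add: less_imp_le)
      also have "\<dots> = 4 * ?m\<^sup>2" using sum_overlap[OF X] by (simp add: sum_distrib_left[symmetric])
      finally have "?m * (3 * p) \<le> ?m * (4 * ?m)" using p_gt_1 by (simp add: power2_eq_square ac_simps)
      then have "3 * p \<le> 4 * ?m" using two by simp
      then show False using half two by simp
    qed
    then obtain z where z: "z \<in> Y" "z + x \<notin> Y" using closed_under_step_UNIV[OF pY _ x(2)] Y0 by blast
    have "2 * overlap X (z + x) \<ge> ?m"
      using overlap_add[OF X, of z x] x z unfolding Y_def by simp
    then have "p * ?m \<le> p * (2 * overlap X (z + x))" using p_gt_1 by simp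
    moreover have "?m * (2 * (?m - 1)) \<le> ?m * p" using half two by (intro mult_left_mono) auto
    ultimately have "?m * (?m - 1) \<le> p * overlap X (z + x)" by (simp add: algebra_simps)
    then show thesis using that[of "z + x"] z(2) unfolding Y_def by simp
  next
    case False
    have "\<exists>x\<in>{1..<p}. ?m * (?m - 1) \<le> p * overlap X x"
    proof (rule ccontr)
      assume "\<not> ?thesis"
      then have "(\<Sum>x\<in>{1..<p}. p * overlap X x) \<le> (\<Sum>x\<in>{1..<p}. ?m * (?m - 1) - 1)"
        by (intro sum_mono) (simp add: not_le)
      also have "\<dots> = (p - 1) * (?m * (?m - 1) - 1)" using p_gt_1 by simp
      also have "\<dots> < p * (?m * (?m - 1))"
      proof -
        have "?m * (?m - 1) > 0" using two by simp
        then show ?thesis using p_gt_1 by (simp add: algebra_simps)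
      qed
      finally have "p * (\<Sum>x\<in>{1..<p}. overlap X x) < p * (?m * (?m - 1))"
        by (simp add: sum_distrib_left)
      moreover have "(\<Sum>x\<in>{0..<p}. overlap X x) = overlap X 0 + (\<Sum>x\<in>{1..<p}. overlap X x)"
      proof -
        have "{0..<p} = insert 0 {1..<p}" using p_gt_1 by auto
        then show ?thesis by simp
      qed
      ultimately show False using sum_overlap[OF X] overlap_0[of X] p_gt_1
        by (simp add: power2_eq_square algebra_simps)
    qed
    then obtain x where x: "x \<in> {1..<p}" "?m * (?m - 1) \<le> p * overlap X x" by blast
    then have "\<not> p dvd x" by (simp add: zdvd_not_zless)
    then have "x \<notin> Y" using False by blast
    then show thesis using that[of x] x unfolding Y_def by simp
  qed
qed

text \<open>
Write \<open>A'\<close> for the translate of \<open>A\<close> by \<open>x\<close>. The map \<open>A \<mapsto> \<mu> (A + S)\<close> is submodular, so the excesses of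
\<open>A \<inter> A'\<close> and \<open>A \<union> A'\<close> together are at most the excesses of \<open>A\<close> and \<open>A'\<close>, which are equal. The excess
of the union is nonnegative by Cauchy-Davenport, and the hypothesis \<open>small\<close> makes this true even when the
sumset of the union is everything.
\<close>

lemma plus_Int_translate_excess:
  assumes S: "periodic S" "S \<noteq> {}" and A: "periodic A"
    and x: "overlap A x \<ge> 1" and small: "2 * \<mu> A + \<mu> S \<le> p"
  shows "\<mu> ((A \<inter> {y. y - x \<in> A}) + S) - overlap A x - \<mu> S + 1 \<le> 2 * (\<mu> (A + S) - \<mu> A - \<mu> S + 1)"
proof -
  let ?A' = "{y. y - x \<in> A}"
  have pA': "periodic ?A'" using A by blast
  have ne: "A \<noteq> {}" using x unfolding overlap_def \<mu>_def by (cases "A = {}") auto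
  have A': "\<mu> ?A' = \<mu> A" by (rule mu_translate[OF A])
  have un: "\<mu> (A \<union> ?A') = 2 * \<mu> A - overlap A x"
    using mu_Un_Int[of A ?A'] A' unfolding overlap_def by simp
  have "?A' + S = {y. y - x \<in> A + S}"
  proof (intro equalityI subsetI)
    fix y assume "y \<in> ?A' + S"
    then obtain a s where as: "a - x \<in> A" "s \<in> S" "y = a + s" by (auto elim!: set_plus_elim)
    then have "(a - x) + s \<in> A + S" by (intro set_plus_intro)
    then show "y \<in> {y. y - x \<in> A + S}" using as by (simp add: algebra_simps)
  next
    fix y assume "y \<in> {y. y - x \<in> A + S}"
    then obtain a s where as: "a \<in> A" "s \<in> S" "y - x = a + s" by (auto elim!: set_plus_elim)
    then have "(a + x) + s \<in> ?A' + S" by (intro set_plus_intro) auto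
    moreover have "y = (a + x) + s" using as by simp
    ultimately show "y \<in> ?A' + S" by simp
  qed
  then have sA': "\<mu> (?A' + S) = \<mu> (A + S)" using mu_translate[of "A + S" x] A by auto
  have "\<mu> ((A \<inter> ?A') + S) + \<mu> ((A \<union> ?A') + S) \<le> \<mu> (A + S) + \<mu> (?A' + S)"
  proof -
    have "(A \<union> ?A') + S = (A + S) \<union> (?A' + S)" by (auto simp: set_plus_def)
    moreover have "\<mu> ((A \<inter> ?A') + S) \<le> \<mu> ((A + S) \<inter> (?A' + S))"
      by (rule mu_mono) (auto simp: set_plus_def)
    ultimately show ?thesis using mu_Un_Int[of "A + S" "?A' + S"] by simp
  qed
  moreover have "\<mu> ((A \<union> ?A') + S) \<ge> \<mu> (A \<union> ?A') + \<mu> S - 1"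
  proof -
    have "(A \<union> ?A') + S = UNIV \<or> \<mu> ((A \<union> ?A') + S) \<ge> \<mu> (A \<union> ?A') + \<mu> S - 1"
      by (rule Cauchy_Davenport) (use A S ne in auto)
    then show ?thesis
    proof
      assume "(A \<union> ?A') + S = UNIV"
      then have "\<mu> ((A \<union> ?A') + S) = p" using mu_UNIV by metis
      then show ?thesis using un small x by linarith
    qed
  qed
  moreover define u v w where "u = \<mu> ((A \<inter> ?A') + S)" and "v = \<mu> ((A \<union> ?A') + S)" and "w = \<mu> (A + S)"
  ultimately have "u + v \<le> 2 * w" "v \<ge> 2 * \<mu> A - overlap A x + \<mu> S - 1"
    using un sA' by simp_all
  then have "u - overlap A x - \<mu> S + 1 \<le> 2 * (w - \<mu> A - \<mu> S + 1)" by simp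
  then show ?thesis unfolding u_def w_def .
qed

end

section \<open>Translations that almost preserve a set\<close>

context modulus begin

definition almost_periods :: "int set \<Rightarrow> int \<Rightarrow> int set" where
  "almost_periods S k = {x. \<mu> S - overlap S x \<le> k}"

lemma periodic_almost_periods [intro]: "periodic S \<Longrightarrow> periodic (almost_periods S k)"
  unfolding almost_periods_def by (rule periodicI) (use overlap_cong in auto)

lemma almost_periods_uminus: "periodic S \<Longrightarrow> - x \<in> almost_periods S k \<longleftrightarrow> x \<in> almost_periods S k"
  unfolding almost_periods_def using overlap_uminus by simp

lemma almost_periods_0: "k \<ge> 0 \<Longrightarrow> 0 \<in> almost_periods S k"
  unfolding almost_periods_def by (simp add: overlap_0)

lemma almost_periods_mono: "i \<le> j \<Longrightarrow> almost_periods S i \<subseteq> almost_periods S j"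
  unfolding almost_periods_def by auto

lemma almost_periods_add:
  assumes "periodic S" "x \<in> almost_periods S i" "y \<in> almost_periods S j" shows "x + y \<in> almost_periods S (i + j)"
  using overlap_add[OF assms(1), of x y] assms(2,3) unfolding almost_periods_def by simp

text \<open>
For a sum-free \<open>S\<close> and \<open>x \<in> S\<close>, the sets \<open>S\<close> and \<open>S + x\<close> are disjoint.
\<close>

lemma almost_periods_disjoint:
  assumes sf: "\<And>a b. a \<in> S \<Longrightarrow> b \<in> S \<Longrightarrow> a + b \<notin> S" and k: "k < \<mu> S"
  shows "almost_periods S k \<inter> S = {}"
proof -
  have "overlap S x = 0" if "x \<in> S" for x
  proof -
    have "S \<inter> {y. y - x \<in> S} = {}" using sf[OF _ that] by force
    then show ?thesis unfolding overlap_def by (simp add: \<mu>_def)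
  qed
  then show ?thesis using k unfolding almost_periods_def by auto
qed

lemma mu_almost_periods_le:
  assumes "\<And>a b. a \<in> S \<Longrightarrow> b \<in> S \<Longrightarrow> a + b \<notin> S" "k < \<mu> S"
  shows "\<mu> (almost_periods S k) \<le> p - \<mu> S"
  using mu_Un_Int[of "almost_periods S k" S] almost_periods_disjoint[OF assms] mu_le[of "almost_periods S k \<union> S"]
  by (simp add: \<mu>_def)

text \<open>
Both \<open>S + x\<close> and \<open>S + y\<close> are contained in \<open>A + S\<close>, hence they can only differ by as many elements as
\<open>A + S\<close> has more than \<open>S\<close>.
\<close>

lemma diff_in_almost_periods:
  assumes S: "periodic S" and "x \<in> A" "y \<in> A"
  shows "x - y \<in> almost_periods S (\<mu> (A + S) - \<mu> S)"
proof -
  let ?X = "{z. z - x \<in> S}" and ?Y = "{z. z - y \<in> S}"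
  have "?X \<union> ?Y \<subseteq> A + S"
  proof
    fix z assume "z \<in> ?X \<union> ?Y"
    then have "x + (z - x) \<in> A + S \<or> y + (z - y) \<in> A + S" using assms(2,3) by blast
    then show "z \<in> A + S" by simp
  qed
  then have 1: "\<mu> (?X \<union> ?Y) \<le> \<mu> (A + S)" by (rule mu_mono)
  have "{z. z - y \<in> S \<inter> {w. w - (x - y) \<in> S}} = ?X \<inter> ?Y" by (auto simp: algebra_simps)
  then have "\<mu> (?X \<inter> ?Y) = overlap S (x - y)"
    unfolding overlap_def using mu_translate[of "S \<inter> {w. w - (x - y) \<in> S}" y] S by auto
  then show ?thesis unfolding almost_periods_def
    using 1 mu_Un_Int[of ?X ?Y] mu_translate[OF S, of x] mu_translate[OF S, of y] by simp
qed

end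

context prime_modulus begin

text \<open>
Each of the \<open>j\<close> steps intersects \<open>A\<close> with a translate of moderate overlap: the size shrinks at least by
the factor \<open>3/4\<close>, the excess at most doubles. The descent stops once \<open>A\<close> has at most
\<open>\<mu> S / 2000\<close> elements. The last step starts above that threshold, and one step from size \<open>a\<close> keeps at
least about \<open>a\<^sup>2 / p\<close> elements, so the result is never smaller than \<open>\<mu> S / 10^8\<close>.
\<close>

lemma exists_small_set_small_excess:
  assumes S: "periodic S" and SS: "\<mu> (S + S) \<le> 2 * \<mu> S + 2 * t - 1" and t: "t \<ge> 0"
    and dens: "3 * \<mu> S \<le> p" "p \<le> 4 * \<mu> S" and large: "\<mu> S \<ge> 10^8"
  shows "\<exists>A. periodic A \<and> (2000 * \<mu> A \<le> \<mu> S \<or> 4^j * \<mu> A \<le> 3^j * \<mu> S) \<and> \<mu> S \<le> 10^8 * \<mu> A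
    \<and> \<mu> A \<le> \<mu> S \<and> \<mu> (A + S) - \<mu> A - \<mu> S + 1 \<le> 2^j * (2 * t)"
proof (induction j)
  case 0
  show ?case by (rule exI[of _ S]) (use S SS large in auto)
next
  case (Suc j)
  let ?s = "\<mu> S"
  have Sne: "S \<noteq> {}" using large unfolding \<mu>_def by (cases "S = {}") auto
  from Suc obtain A where A: "periodic A"
    "2000 * \<mu> A \<le> ?s \<or> 4^j * \<mu> A \<le> 3^j * ?s" "?s \<le> 10^8 * \<mu> A" "\<mu> A \<le> ?s"
    "\<mu> (A + S) - \<mu> A - ?s + 1 \<le> 2^j * (2 * t)" by blast
  have pos: "0 \<le> 2^j * (2 * t)" using t by simp
  show ?case
  proof (cases "2000 * \<mu> A \<le> ?s")
    case True
    have "2 ^ Suc j * (2 * t) = 2 * (2^j * (2 * t))" by simp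
    then have "\<mu> (A + S) - \<mu> A - ?s + 1 \<le> 2 ^ Suc j * (2 * t)" using A(5) pos by linarith
    then show ?thesis using A(1,3,4) True by blast
  next
    case False
    let ?a = "\<mu> A"
    have a2: "2 \<le> ?a" and half: "2 * ?a \<le> p" using False large A(4) dens by auto
    obtain x where x: "4 * overlap A x \<le> 3 * ?a" "?a * (?a - 1) \<le> p * overlap A x"
      using exists_moderate_overlap[OF A(1) a2 half] by blast
    let ?r = "overlap A x"
    have "?r \<ge> 0" unfolding overlap_def by (rule mu_nonneg)
    have "?s * ?s \<le> (2000 * ?a) * (4000 * (?a - 1))"
      using False large mu_nonneg[of S] by (intro mult_mono) auto
    also have "\<dots> = 8000000 * (?a * (?a - 1))" by simp
    also have "\<dots> \<le> 8000000 * (p * ?r)" using x(2) by simp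
    also have "\<dots> \<le> 8000000 * ((4 * ?s) * ?r)"
      using dens(2) \<open>?r \<ge> 0\<close> by (intro mult_left_mono mult_right_mono) auto
    also have "\<dots> = ?s * (32000000 * ?r)" by simp
    finally have "?s \<le> 32000000 * ?r" using large by (simp only: mult_le_cancel_left) auto
    then have sr: "?s \<le> 10^8 * ?r" and r1: "1 \<le> ?r" using large \<open>?r \<ge> 0\<close> by simp_all
    let ?A' = "A \<inter> {y. y - x \<in> A}"
    have rA': "\<mu> ?A' = ?r" unfolding overlap_def ..
    have ex: "\<mu> (?A' + S) - ?r - ?s + 1 \<le> 2 * (\<mu> (A + S) - ?a - ?s + 1)"
      by (rule plus_Int_translate_excess[OF S Sne A(1) r1]) (use A(4) dens in linarith)
    have "4^Suc j * ?r \<le> 3^Suc j * ?s"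
    proof -
      have "4^Suc j * ?r = 4^j * (4 * ?r)" by simp
      also have "\<dots> \<le> 4^j * (3 * ?a)" using x(1) by (intro mult_left_mono) auto
      also have "\<dots> = 3 * (4^j * ?a)" by simp
      also have "\<dots> \<le> 3 * (3^j * ?s)" using A(2) False by (intro mult_left_mono) auto
      finally show ?thesis by simp
    qed
    then show ?thesis
      by (intro exI[of _ ?A']) (use rA' ex sr A x r1 \<open>?r \<ge> 0\<close> in auto)
  qed
qed

text \<open>
The sumset is not everything because it misses \<open>S\<close>, so Cauchy-Davenport gives the full lower bound.
\<close>

lemma mu_almost_periods_add:
  assumes S: "periodic S" and sf: "\<And>a b. a \<in> S \<Longrightarrow> b \<in> S \<Longrightarrow> a + b \<notin> S"
    and k: "i \<ge> 0" "j \<ge> 0" "i + j < \<mu> S"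
  shows "\<mu> (almost_periods S (i + j)) \<ge> \<mu> (almost_periods S i) + \<mu> (almost_periods S j) - 1"
proof -
  have sub: "almost_periods S i + almost_periods S j \<subseteq> almost_periods S (i + j)"
    using almost_periods_add[OF S] by (auto elim!: set_plus_elim)
  have "S \<noteq> {}" using k unfolding \<mu>_def by (cases "S = {}") auto
  then have "almost_periods S i + almost_periods S j \<noteq> UNIV" using almost_periods_disjoint[OF sf k(3)] sub by blast
  then have "\<mu> (almost_periods S i + almost_periods S j) \<ge> \<mu> (almost_periods S i) + \<mu> (almost_periods S j) - 1"
    using Cauchy_Davenport[of "almost_periods S i" "almost_periods S j"] S almost_periods_0 k by blast
  then show ?thesis using mu_mono[OF sub] by simp
qed

lemma mu_almost_periods_mult:
  assumes S: "periodic S" and sf: "\<And>a b. a \<in> S \<Longrightarrow> b \<in> S \<Longrightarrow> a + b \<notin> S"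
    and k: "k \<ge> 0" "int n * k < \<mu> S"
  shows "\<mu> (almost_periods S (int n * k)) \<ge> int n * (\<mu> (almost_periods S k) - 1) + 1"
  using k(2)
proof (induction n)
  case 0 
  have "\<mu> (almost_periods S 0) \<ge> 1" using mu_pos[OF periodic_almost_periods[OF S] almost_periods_0] by simp
  then show ?case by simp
next
  case (Suc n)
  have lt: "int n * k < \<mu> S" using Suc.prems k(1) by (simp add: algebra_simps)
  have "\<mu> (almost_periods S (k + int n * k)) \<ge> \<mu> (almost_periods S k) + \<mu> (almost_periods S (int n * k)) - 1"
    by (rule mu_almost_periods_add[OF S sf]) (use k Suc.prems in \<open>auto simp: algebra_simps\<close>)
  then show ?case using Suc.IH[OF lt] by (simp add: algebra_simps)
qed

text \<open>
All differences of elements of \<open>A\<close> are almost-periods, and there are at least \<open>2 * \<mu> A - 1\<close> of them.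
\<close>

lemma mu_almost_periods_ge:
  assumes S: "periodic S" and Sne: "S \<noteq> {}" and sf: "\<And>a b. a \<in> S \<Longrightarrow> b \<in> S \<Longrightarrow> a + b \<notin> S"
    and A: "periodic A" "A \<noteq> {}" and k: "\<mu> (A + S) - \<mu> S < \<mu> S"
  shows "\<mu> (almost_periods S (\<mu> (A + S) - \<mu> S)) \<ge> 2 * \<mu> A - 1"
proof -
  let ?B = "{y. - y \<in> A}"
  have pB: "periodic ?B"
    by (rule periodicI) (use A periodicD cong_minus_minus_iff in blast)
  obtain a where "a \<in> A" using A by blast
  then have "- a \<in> ?B" by simp
  then have neB: "?B \<noteq> {}" by blast
  have sub: "A + ?B \<subseteq> almost_periods S (\<mu> (A + S) - \<mu> S)"
  proof
    fix x assume "x \<in> A + ?B"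
    then obtain a b where "a \<in> A" "- b \<in> A" "x = a + b" by (auto elim!: set_plus_elim)
    then show "x \<in> almost_periods S (\<mu> (A + S) - \<mu> S)" using diff_in_almost_periods[OF S, of a A "- b"] by simp
  qed
  have "A + ?B \<noteq> UNIV" using Sne almost_periods_disjoint[OF sf k] sub by blast
  then have "\<mu> (A + ?B) \<ge> \<mu> A + \<mu> ?B - 1" using Cauchy_Davenport[OF A pB neB] by blast
  then show ?thesis using mu_mono[OF sub] mu_uminus[OF A(1)] by simp
qed

end

section \<open>A character concentrating the almost-periods\<close>

lemma sum_cos_residues:
  fixes p y :: int assumes p: "p > 0"
  shows "(\<Sum>r\<in>{0..<p}. cos (2 * pi * of_int (r * y) / of_int p)) = (if p dvd y then of_int p else 0)"
proof (cases "p dvd y")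
  case True
  then obtain m where m: "y = p * m" by blast
  have "cos (2 * pi * of_int (r * y) / of_int p) = 1" for r
  proof -
    have "2 * pi * of_int (r * y) / of_int p = 2 * pi * of_int (r * m)" using p m by simp
    then show ?thesis using cos_int_2pin by metis
  qed
  then show ?thesis using True p by simp
next
  case False
  define z where "z = cis (2 * pi * of_int y / of_int p)"
  have pow: "z ^ n = cis (2 * pi * of_int (int n * y) / of_int p)" for n
    unfolding z_def by (simp add: DeMoivre field_simps)
  have "z \<noteq> 1"
  proof
    assume "z = 1"
    then have "cos (2 * pi * of_int y / of_int p) = 1" unfolding z_def by (metis cis.sel(1) one_complex.sel(1))
    then obtain m :: int where "2 * pi * of_int y / of_int p = of_int m * 2 * pi" using cos_one_2pi_int by blast
    then have "of_int y = (of_int (m * p) :: real)" using p by (simp add: field_simps)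
    then have "y = m * p" by linarith
    then show False using False by simp
  qed
  have "2 * pi * of_int (int (nat p) * y) / of_int p = 2 * pi * of_int y" using p by simp
  then have "z ^ nat p = cis (2 * pi * of_int y)" unfolding pow by (rule arg_cong)
  also have "\<dots> = 1" by (rule cis_multiple_2pi) simp
  finally have "z ^ nat p = 1" .
  then have "(\<Sum>n<nat p. z ^ n) = 0" using geometric_sum[OF \<open>z \<noteq> 1\<close>] by simp
  then have "(\<Sum>n<nat p. Re (z ^ n)) = 0" by (metis Re_sum zero_complex.sel(1))
  then have 0: "(\<Sum>n<nat p. cos (2 * pi * of_int (int n * y) / of_int p)) = 0"
    unfolding pow by simp
  have "(\<Sum>r\<in>{0..<p}. cos (2 * pi * of_int (r * y) / of_int p))
      = (\<Sum>n\<in>{..<nat p}. cos (2 * pi * of_int (int n * y) / of_int p))"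
    by (rule sum.reindex_bij_witness[where i = int and j = nat]) auto
  then show ?thesis using 0 False by simp
qed

text \<open>
Up to the factor \<open>cos x\<close>, the left-hand side is the squared modulus of the exponential sum
\<open>\<Sum>a\<in>A. cis (f a)\<close>. The sines of the differences cancel in pairs.
\<close>

lemma sum_cos_sin_product:
  fixes f g :: "'a \<Rightarrow> real"
  shows "((\<Sum>a\<in>A. cos (f a))\<^sup>2 + (\<Sum>a\<in>A. sin (f a))\<^sup>2) * cos x
     = (\<Sum>a\<in>A. \<Sum>b\<in>A. cos (f a - f b - x))"
proof -
  have "(\<Sum>a\<in>A. \<Sum>b\<in>A. sin (f a - f b)) = (\<Sum>a\<in>A. \<Sum>b\<in>A. sin (f b - f a))"
    by (rule sum.swap)
  also have "\<dots> = (\<Sum>a\<in>A. \<Sum>b\<in>A. - sin (f a - f b))"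
    by (intro sum.cong) (auto simp: sin_diff)
  finally have 0: "(\<Sum>a\<in>A. \<Sum>b\<in>A. sin (f a - f b)) = 0" by (simp add: sum_negf)
  have "(\<Sum>a\<in>A. cos (f a))\<^sup>2 + (\<Sum>a\<in>A. sin (f a))\<^sup>2 = (\<Sum>a\<in>A. \<Sum>b\<in>A. cos (f a - f b))"
    by (simp add: power2_eq_square sum_product cos_diff sum.distrib)
  then have "((\<Sum>a\<in>A. cos (f a))\<^sup>2 + (\<Sum>a\<in>A. sin (f a))\<^sup>2) * cos x
     = (\<Sum>a\<in>A. \<Sum>b\<in>A. cos (f a - f b)) * cos x + (\<Sum>a\<in>A. \<Sum>b\<in>A. sin (f a - f b)) * sin x"
    using 0 by simp
  also have "\<dots> = (\<Sum>a\<in>A. \<Sum>b\<in>A. cos (f a - f b - x))"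
    by (simp add: sum_distrib_right sum.distrib[symmetric] cos_diff[of "_ - _" x])
  finally show ?thesis .
qed


context modulus begin

text \<open>
The squared modulus of the Fourier coefficient of \<open>X\<close> at the frequency \<open>r\<close>.
\<close>

definition spectrum :: "int set \<Rightarrow> int \<Rightarrow> real" where
  "spectrum X r = (\<Sum>a\<in>X \<inter> {0..<p}. cos (2 * pi * of_int (r * a) / of_int p))\<^sup>2
     + (\<Sum>a\<in>X \<inter> {0..<p}. sin (2 * pi * of_int (r * a) / of_int p))\<^sup>2"

lemma spectrum_0: "spectrum X 0 = (of_int (\<mu> X))\<^sup>2"
  unfolding spectrum_def \<mu>_def by simp

text \<open>
Fourier inversion for the autocorrelation of \<open>X\<close>.
\<close>

lemma sum_spectrum_cos:
  assumes X: "periodic X"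
  shows "(\<Sum>r\<in>{0..<p}. spectrum X r * cos (2 * pi * of_int (r * x) / of_int p)) = of_int (p * overlap X x)"
proof -
  let ?X = "X \<inter> {0..<p}"
  have "spectrum X r * cos (2 * pi * of_int (r * x) / of_int p)
      = (\<Sum>a\<in>?X. \<Sum>b\<in>?X. cos (2 * pi * of_int (r * (a - b - x)) / of_int p))" for r
  proof -
    have "2 * pi * of_int (r * a) / of_int p - 2 * pi * of_int (r * b) / of_int p - 2 * pi * of_int (r * x) / of_int p
       = 2 * pi * of_int (r * (a - b - x)) / of_int p" for a b
      using p_gt_1 by (simp add: field_simps)
    then show ?thesis unfolding spectrum_def sum_cos_sin_product by simp
  qed
  then have "(\<Sum>r\<in>{0..<p}. spectrum X r * cos (2 * pi * of_int (r * x) / of_int p))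
      = (\<Sum>r\<in>{0..<p}. \<Sum>a\<in>?X. \<Sum>b\<in>?X. cos (2 * pi * of_int (r * (a - b - x)) / of_int p))"
    by simp
  also have "\<dots> = (\<Sum>a\<in>?X. \<Sum>r\<in>{0..<p}. \<Sum>b\<in>?X. cos (2 * pi * of_int (r * (a - b - x)) / of_int p))"
    by (rule sum.swap)
  also have "\<dots> = (\<Sum>a\<in>?X. \<Sum>b\<in>?X. \<Sum>r\<in>{0..<p}. cos (2 * pi * of_int (r * (a - b - x)) / of_int p))"
    by (intro sum.cong refl sum.swap)
  also have "\<dots> = (\<Sum>a\<in>?X. \<Sum>b\<in>?X. if p dvd a - b - x then of_int p else 0)"
    by (intro sum.cong refl sum_cos_residues) (use p_gt_1 in simp)
  also have "\<dots> = (\<Sum>a\<in>?X. if a - x \<in> X then of_int p else 0)"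
  proof (rule sum.cong[OF refl])
    fix a
    have "{b \<in> ?X. p dvd a - b - x} = (if a - x \<in> X then {(a - x) mod p} else {})"
    proof -
      have dvd: "p dvd a - b - x \<longleftrightarrow> b mod p = (a - x) mod p" for b
      proof -
        have "a - b - x = - (b - (a - x))" by simp
        then show ?thesis by (simp only: mod_eq_dvd_iff dvd_minus_iff)
      qed
      have small: "b mod p = b" if "b \<in> ?X" for b using that by simp
      have "{b \<in> ?X. p dvd a - b - x} = {b \<in> ?X. b = (a - x) mod p}"
        by (intro Collect_cong conj_cong refl) (simp only: dvd small)
      also have "\<dots> = (if a - x \<in> X then {(a - x) mod p} else {})"
        using periodic_mod[OF X, of "a - x"] p_gt_1 by auto
      finally show ?thesis .
    qed
    then have "card {b \<in> ?X. p dvd a - b - x} = (if a - x \<in> X then 1 else 0)" by simp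
    then show "(\<Sum>b\<in>?X. if p dvd a - b - x then of_int p else 0) = (if a - x \<in> X then of_int p else (0::real))"
      by (simp add: sum.If_cases Int_def)
  qed
  also have "\<dots> = of_int (p * overlap X x)"
  proof -
    have "X \<inter> {y. y - x \<in> X} \<inter> {0..<p} = {a \<in> ?X. a - x \<in> X}" by blast
    then show ?thesis unfolding overlap_def \<mu>_def by (simp add: sum.If_cases Int_def)
  qed
  finally show ?thesis .
qed

lemma sum_spectrum_nontrivial:
  assumes "periodic X"
  shows "(\<Sum>r\<in>{1..<p}. spectrum X r * (1 - cos (2 * pi * of_int (r * x) / of_int p)))
      = of_int (p * (\<mu> X - overlap X x))"
    and "(\<Sum>r\<in>{1..<p}. spectrum X r) = of_int (\<mu> X * (p - \<mu> X))"
proof -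
  have split: "{0..<p} = insert 0 {1..<p}" using p_gt_1 by auto
  have full: "(\<Sum>r\<in>{0..<p}. spectrum X r) = of_int (p * \<mu> X)"
    using sum_spectrum_cos[OF assms, of 0] by (simp add: overlap_0)
  have "(\<Sum>r\<in>{0..<p}. spectrum X r * (1 - cos (2 * pi * of_int (r * x) / of_int p)))
      = of_int (p * (\<mu> X - overlap X x))"
    using full sum_spectrum_cos[OF assms, of x] by (simp add: algebra_simps sum_subtractf)
  then show "(\<Sum>r\<in>{1..<p}. spectrum X r * (1 - cos (2 * pi * of_int (r * x) / of_int p)))
      = of_int (p * (\<mu> X - overlap X x))"
    unfolding split by simp
  show "(\<Sum>r\<in>{1..<p}. spectrum X r) = of_int (\<mu> X * (p - \<mu> X))"
    using full spectrum_0[of X] unfolding split by (simp add: power2_eq_square algebra_simps)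
qed

text \<open>
By Fourier inversion, each almost-period \<open>x\<close> makes the average of \<open>1 - cos (2 * pi * r * x / p)\<close> over the
frequencies \<open>r\<close>, weighted by the spectrum of \<open>X\<close>, small. The nontrivial frequencies have total weight
\<open>\<mu> X * (p - \<mu> X)\<close>, so after summation over all almost-periods one of them is at least as good as the
average.
\<close>

lemma exists_flat_character:
  assumes X: "periodic X" and s: "0 < \<mu> X" "\<mu> X < p"
  obtains r where "r \<in> {1..<p}"
    "of_int (\<mu> X * (p - \<mu> X)) * (\<Sum>x\<in>almost_periods X k \<inter> {0..<p}. 1 - cos (2 * pi * of_int (r * x) / of_int p))
       \<le> of_int (\<mu> (almost_periods X k) * p * k)"
proof -
  let ?B = "almost_periods X k \<inter> {0..<p}" and ?W = "real_of_int (\<mu> X * (p - \<mu> X))"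
  define D where "D r = (\<Sum>x\<in>?B. 1 - cos (2 * pi * of_int (r * x) / of_int p))" for r
  let ?c = "real_of_int (\<mu> (almost_periods X k) * p * k)"
  have W: "?W > 0" using s by simp
  have "(\<Sum>r\<in>{1..<p}. spectrum X r * D r)
      = (\<Sum>r\<in>{1..<p}. \<Sum>x\<in>?B. spectrum X r * (1 - cos (2 * pi * of_int (r * x) / of_int p)))"
    unfolding D_def by (simp add: sum_distrib_left)
  also have "\<dots> = (\<Sum>x\<in>?B. \<Sum>r\<in>{1..<p}. spectrum X r * (1 - cos (2 * pi * of_int (r * x) / of_int p)))"
    by (rule sum.swap)
  also have "\<dots> = (\<Sum>x\<in>?B. of_int (p * (\<mu> X - overlap X x)))"
    by (simp only: sum_spectrum_nontrivial(1)[OF X])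
  also have "\<dots> \<le> (\<Sum>x\<in>?B. of_int (p * k))"
  proof (intro sum_mono of_int_le_iff[THEN iffD2] mult_left_mono)
    fix x assume "x \<in> ?B" then show "\<mu> X - overlap X x \<le> k" unfolding almost_periods_def by simp
  qed (use p_gt_1 in simp)
  also have "\<dots> = ?c" unfolding \<mu>_def by simp
  finally have upper: "(\<Sum>r\<in>{1..<p}. spectrum X r * D r) \<le> ?c" .
  have "\<exists>r\<in>{1..<p}. ?W * D r \<le> ?c"
  proof (rule ccontr)
    assume "\<not> ?thesis"
    then have gt: "?W * D r - ?c > 0" if "r \<in> {1..<p}" for r using that by force
    have "(\<Sum>r\<in>{1..<p}. spectrum X r) > 0" using sum_spectrum_nontrivial(2)[OF X] W by simp
    then obtain r where r: "r \<in> {1..<p}" "spectrum X r > 0"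
      by (meson not_less sum_nonpos)
    have "0 < (\<Sum>r\<in>{1..<p}. spectrum X r * (?W * D r - ?c))"
    proof (rule sum_pos2[OF _ r(1)])
      show "0 < spectrum X r * (?W * D r - ?c)" using r gt by simp
      show "0 \<le> spectrum X q * (?W * D q - ?c)" if "q \<in> {1..<p}" for q
        using gt[OF that] by (intro mult_nonneg_nonneg) (auto simp: spectrum_def)
    qed simp
    also have "\<dots> = ?W * (\<Sum>r\<in>{1..<p}. spectrum X r * D r) - ?c * (\<Sum>r\<in>{1..<p}. spectrum X r)"
      by (simp add: right_diff_distrib sum_subtractf sum_distrib_left sum_distrib_right ac_simps)
    also have "\<dots> \<le> ?W * ?c - ?c * ?W"
      using mult_left_mono[OF upper, of ?W] W sum_spectrum_nontrivial(2)[OF X] by (simp add: mult.commute)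
    finally show False by simp
  qed
  then show thesis using that unfolding D_def by blast
qed

end

context prime_modulus begin

text \<open>
An almost-period \<open>x\<close> for which \<open>r * x\<close> is not congruent to an element of \<open>[-p/6, p/6]\<close> contributes at
least \<open>1/2\<close> to the sum of the flat character, so there are few of them. The multiplier \<open>e\<close> is the
inverse of \<open>r\<close>.
\<close>

lemma almost_periods_concentrated:
  assumes X: "periodic X" and s: "0 < \<mu> X" "\<mu> X < p"
  obtains e where "\<not> p dvd e"
    "\<mu> X * (p - \<mu> X) * (\<mu> (almost_periods X k) - int (card {c. 6 * \<bar>c\<bar> \<le> p \<and> e * c \<in> almost_periods X k}))
       \<le> 2 * (\<mu> (almost_periods X k) * p * k)"
proof -
  obtain r where r: "r \<in> {1..<p}"
    and rD: "of_int (\<mu> X * (p - \<mu> X)) * (\<Sum>x\<in>almost_periods X k \<inter> {0..<p}. 1 - cos (2 * pi * of_int (r * x) / of_int p))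
       \<le> of_int (\<mu> (almost_periods X k) * p * k)" using exists_flat_character[OF assms] by blast
  have "\<not> p dvd r" using r by (simp add: zdvd_not_zless)
  then obtain e where e: "[r * e = 1] (mod p)" "\<not> p dvd e" using inverse_mod_p by blast
  let ?N = "almost_periods X k"
  define C where "C = {c. 6 * \<bar>c\<bar> \<le> p \<and> e * c \<in> ?N}"
  define G where "G = {x \<in> ?N \<inter> {0..<p}. cos (2 * pi * of_int (r * x) / of_int p) \<ge> 1/2}"
  define H where "H = {x \<in> ?N \<inter> {0..<p}. \<not> cos (2 * pi * of_int (r * x) / of_int p) \<ge> 1/2}"
  define centre where "centre x = (let m = x mod p in if 2 * m \<le> p then m else m - p)" for x
  have centre: "[centre x = x] (mod p)" "2 * \<bar>centre x\<bar> \<le> p" for x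
  proof -
    have m: "0 \<le> x mod p" "x mod p < p" using p_gt_1 by simp_all
    show "[centre x = x] (mod p)" unfolding centre_def Let_def cong_def by simp
    show "2 * \<bar>centre x\<bar> \<le> p" unfolding centre_def Let_def using m by auto
  qed
  have inC: "centre (r * x) \<in> C" if x: "x \<in> G" for x
  proof -
    \<comment> \<open>The representative of \<open>r * x\<close> of least absolute value.\<close>
    define c where "c = centre (r * x)"
    note c = centre[of "r * x", folded c_def]
    obtain m where m: "r * x = c + p * m"
      using c(1) by (metis cong_iff_lin)
    have arg: "2 * pi * of_int (r * x) / of_int p = 2 * pi * of_int c / of_int p + 2 * pi * of_int m"
      using p_gt_1 by (simp add: m field_simps)
    have period: "cos (y + 2 * pi * of_int m) = cos y" for y
      by (simp add: cos_add)
    have "cos (2 * pi * of_int (r * x) / of_int p) = cos (2 * pi * of_int c / of_int p)"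
      unfolding arg by (rule period)
    also have "\<dots> = cos (2 * pi * \<bar>of_int c\<bar> / of_int p)" by (simp add: abs_if)
    finally have half: "cos (2 * pi * \<bar>of_int c\<bar> / of_int p) \<ge> 1/2" using x unfolding G_def by simp
    have "6 * \<bar>c\<bar> \<le> p"
    proof (rule ccontr)
      assume "\<not> ?thesis"
      then have "of_int p < (of_int (6 * \<bar>c\<bar>) :: real)" by (subst of_int_less_iff) simp
      then have "pi / 3 < 2 * pi * \<bar>of_int c\<bar> / of_int p" using p_gt_1 by (simp add: field_simps)
      moreover have "of_int (2 * \<bar>c\<bar>) \<le> (of_int p :: real)" using c(2) by (subst of_int_le_iff)
      then have "2 * pi * \<bar>of_int c\<bar> / of_int p \<le> pi" using p_gt_1 by (simp add: field_simps)
      ultimately have "cos (2 * pi * \<bar>of_int c\<bar> / of_int p) < cos (pi / 3)"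
        by (intro cos_monotone_0_pi) auto
      then show False using half by (simp add: cos_60)
    qed
    moreover have "[e * c = x] (mod p)"
    proof -
      have "[e * c = e * (r * x)] (mod p)" by (intro cong_mult c cong_refl)
      also have "e * (r * x) = (r * e) * x" by simp
      also have "[(r * e) * x = 1 * x] (mod p)" by (intro cong_mult e cong_refl)
      finally show ?thesis by simp
    qed
    then have "e * c \<in> ?N" using x periodicD[OF periodic_almost_periods[OF X]] unfolding G_def by blast
    ultimately show ?thesis unfolding C_def c_def by blast
  qed
  have "inj_on (\<lambda>x. centre (r * x)) G"
  proof (rule inj_onI)
    fix x y assume xy: "x \<in> G" "y \<in> G" "centre (r * x) = centre (r * y)"
    then have "[r * x = r * y] (mod p)" using centre(1) by (metis cong_sym cong_trans)
    then have "[e * (r * x) = e * (r * y)] (mod p)" by (rule cong_mult[OF cong_refl])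
    moreover have "[e * (r * z) = z] (mod p)" for z
      using cong_mult[OF e(1) cong_refl[of z]] by (simp add: ac_simps)
    ultimately have "[x = y] (mod p)" by (meson cong_sym cong_trans)
    then show "x = y" using xy unfolding G_def by (simp add: cong_def)
  qed
  moreover have "finite C"
  proof (rule finite_subset)
    show "C \<subseteq> {-p..p}" unfolding C_def using p_gt_1 by auto
  qed simp
  ultimately have GC: "card G \<le> card C" using inC by (intro card_inj_on_le) auto
  have "?N \<inter> {0..<p} = G \<union> H" "G \<inter> H = {}" unfolding G_def H_def by auto
  moreover have "finite G" "finite H" unfolding G_def H_def by (auto intro: finite_subset[of _ "{0..<p}"])
  ultimately have "\<mu> ?N = int (card G) + int (card H)" unfolding \<mu>_def by (simp add: card_Un_disjoint)
  with GC have H: "\<mu> ?N - int (card C) \<le> int (card H)" by simp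
  have "real (card H) / 2 = (\<Sum>x\<in>H. 1 / 2)" by simp
  also have "\<dots> \<le> (\<Sum>x\<in>H. 1 - cos (2 * pi * of_int (r * x) / of_int p))"
    by (rule sum_mono) (auto simp: H_def)
  also have "\<dots> \<le> (\<Sum>x\<in>?N \<inter> {0..<p}. 1 - cos (2 * pi * of_int (r * x) / of_int p))"
    by (rule sum_mono2) (auto simp: H_def)
  finally have "of_int (\<mu> X * (p - \<mu> X)) * (real (card H) / 2) \<le> of_int (\<mu> ?N * p * k)"
    using s by (intro order_trans[OF mult_left_mono rD]) auto
  then have "real_of_int (\<mu> X * (p - \<mu> X) * int (card H)) \<le> of_int (2 * (\<mu> ?N * p * k))" by simp
  then have "\<mu> X * (p - \<mu> X) * int (card H) \<le> 2 * (\<mu> ?N * p * k)" by (simp only: of_int_le_iff)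
  moreover have "\<mu> X * (p - \<mu> X) * (\<mu> ?N - int (card C)) \<le> \<mu> X * (p - \<mu> X) * int (card H)"
    using H s by (intro mult_left_mono) auto
  ultimately show thesis using that[OF e(2)] unfolding C_def by linarith
qed

end

section \<open>Symmetric sets of integers with small doubling\<close>

lemma card_ge_sum_fibers:
  fixes D :: "int set" and g :: "int \<Rightarrow> int"
  assumes "finite D" "M > 0"
    and "\<And>r. r \<in> {0..<M} \<Longrightarrow> \<exists>E \<subseteq> D. (\<forall>x\<in>E. x mod M = r) \<and> g r \<le> int (card E)"
  shows "(\<Sum>r\<in>{0..<M}. g r) \<le> int (card D)"
proof -
  have "(\<Sum>r\<in>{0..<M}. g r) \<le> (\<Sum>r\<in>{0..<M}. int (card {x \<in> D. x mod M = r}))"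
  proof (rule sum_mono)
    fix r assume "r \<in> {0..<M}"
    then obtain E where E: "E \<subseteq> D" "\<forall>x\<in>E. x mod M = r" "g r \<le> int (card E)" using assms(3) by blast
    then have "card E \<le> card {x \<in> D. x mod M = r}" using assms(1) by (intro card_mono) auto
    then show "g r \<le> int (card {x \<in> D. x mod M = r})" using E by simp
  qed
  also have "\<dots> = (\<Sum>r\<in>{0..<M}. \<Sum>x\<in>{x \<in> D. x mod M = r}. 1)" by simp
  also have "\<dots> = (\<Sum>x\<in>D. 1)"
    by (rule sum.group) (use assms in auto)
  finally show ?thesis by simp
qed

lemma three_translates:
  fixes a M :: int assumes "M > 0"
  shows "card {a, a - M, a - 2 * M} = 3" "card {a, a - M} = 2"
    "(a - M) mod M = a mod M" "(a - 2 * M) mod M = a mod M"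
  using assms mod_mult_self2[of a M "- 2"] by (simp_all add: mult.commute)

lemma subgroup_int_generator:
  fixes H :: "int set"
  assumes add: "\<And>x y. x \<in> H \<Longrightarrow> y \<in> H \<Longrightarrow> x + y \<in> H" and neg: "\<And>x. x \<in> H \<Longrightarrow> - x \<in> H"
    and M: "M \<in> H" "M > 0"
  obtains q where "q > 0" "H = {x. q dvd x}"
proof -
  define q where "q = Min ({1..M} \<inter> H)"
  have "q \<in> ({1..M} \<inter> H)" unfolding q_def
  proof (rule Min_in)
    have "M \<in> {1..M} \<inter> H" using M by simp
    then show "{1..M} \<inter> H \<noteq> {}" by blast
  qed simp
  then have q: "q > 0" "q \<le> M" "q \<in> H" by auto
  have min: "q \<le> h" if "h \<in> H" "h > 0" "h \<le> M" for h
    unfolding q_def by (rule Min_le) (use that in auto)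
  have mult_nat: "int n * q \<in> H" for n
  proof (induction n)
    case 0 show ?case using add[OF q(3) neg[OF q(3)]] by simp
  next
    case (Suc n) then show ?case using add[OF q(3) Suc] by (simp add: algebra_simps)
  qed
  have mult: "j * q \<in> H" for j
  proof (cases "j \<ge> 0")
    case True then show ?thesis using mult_nat[of "nat j"] by simp
  next
    case False then show ?thesis using neg[OF mult_nat[of "nat (- j)"]] by simp
  qed
  have "q dvd h" if "h \<in> H" for h
  proof -
    have "h + (- (h div q)) * q \<in> H" using add[OF that mult] .
    then have "h mod q \<in> H" by (simp add: minus_mult_div_eq_mod algebra_simps)
    moreover have "0 \<le> h mod q" "h mod q < q" using q by simp_all
    ultimately have "h mod q = 0" using min[of "h mod q"] q(2) by (meson not_le leD le_less_trans less_imp_le order_antisym_conv)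
    then show ?thesis by auto
  qed
  then have "H = {x. q dvd x}" using mult by (auto elim!: dvdE simp: mult.commute)
  with q that show thesis by blast
qed

lemma card_multiples:
  fixes q m :: int assumes "q > 0" "m \<ge> 0"
  shows "int (card {r \<in> {0..<q * m}. q dvd r}) = m"
proof -
  have "{r \<in> {0..<q * m}. q dvd r} = (\<lambda>i. q * i) ` {0..<m}"
    using assms by (auto elim!: dvdE simp: zero_le_mult_iff)
  moreover have "inj_on (\<lambda>i. q * i) {0..<m}" using assms by (auto simp: inj_on_def)
  ultimately show ?thesis using assms by (simp add: card_image)
qed

text \<open>
Reduce modulo the largest element \<open>M\<close> of \<open>C\<close>. Since \<open>C + C\<close> contains \<open>C + {-M, 0, M}\<close>, a nonzero residue
hit by \<open>C\<close> has at least three elements of \<open>C + C\<close> above it, and four if it is hit twice, by some \<open>r\<close> and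
\<open>r - M\<close>. The doubling hypothesis then forces almost all residues that are hit to be hit twice. Let \<open>W\<close>
be the set of integers in the doubly hit residue classes.

Every class in \<open>W + W\<close> has three elements of \<open>C + C\<close> above it, so \<open>W + W\<close> occupies fewer than
\<open>3/2\<close> times as many classes as \<open>W\<close>. Hence any two translates of \<open>W\<close> by elements of \<open>W\<close> share more than
half of \<open>W\<close>, and this makes the symmetric set \<open>W + W\<close> a subgroup, the multiples of some \<open>q\<close>.
An element of \<open>C\<close> outside this subgroup would produce too many further elements of \<open>C + C\<close>. Finally every
multiple of \<open>q\<close> modulo \<open>M\<close> has an element of \<open>C + C\<close> above it, and counting once more bounds \<open>M / q\<close>.
\<close>

lemma symmetric_small_doubling:
  fixes C :: "int set"
  assumes fin: "finite C" and sym: "\<And>c. c \<in> C \<Longrightarrow> - c \<in> C" and zero: "0 \<in> C"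
    and card: "int (card C) = 2 * k + 1" and k: "k \<ge> 1"
    and doubling: "10 * int (card (C + C)) \<le> 41 * k"
  obtains q where "q > 0" "\<And>c. c \<in> C \<Longrightarrow> q dvd c" "\<And>c. c \<in> C \<Longrightarrow> 10 * \<bar>c\<bar> \<le> 11 * k * q"
proof -
  define M where "M = Max C"
  have MC: "M \<in> C" unfolding M_def by (rule Max_in) (use fin zero in auto)
  have le_M: "c \<le> M" if "c \<in> C" for c unfolding M_def using fin that by auto
  have ge_M: "- M \<le> c" if "c \<in> C" for c using le_M[OF sym[OF that]] by simp
  have "M \<noteq> 0"
  proof
    assume "M = 0"
    then have "C \<subseteq> {0}" using le_M ge_M by force
    then have "card C \<le> card {0::int}" by (intro card_mono) auto
    then show False using card k by simp
  qed
  then have M: "M > 0" using le_M[OF zero] by simp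
  let ?D = "C + C"
  have finD: "finite ?D" using fin by (rule finite_set_plus[OF _ fin])
  \<comment> \<open>A nonzero residue \<open>r\<close> can be hit by \<open>r\<close> itself or by \<open>r - M\<close>; \<open>U\<close> collects the residues that are hit
    at all, \<open>V\<close> those that are hit twice.\<close>
  define P where "P = {r \<in> {1..<M}. r \<in> C}"
  define P' where "P' = {r \<in> {1..<M}. r - M \<in> C}"
  define U where "U = P \<union> P'"
  define V where "V = P \<inter> P'"
  have "P \<subseteq> {1..<M}" "P' \<subseteq> {1..<M}" unfolding P_def P'_def by auto
  then have "finite P" "finite P'" by (auto intro: finite_subset)
  then have finP: "finite P" "finite P'" "finite U" "finite V" unfolding U_def V_def by auto
  have bij: "card P' = card P"
  proof (rule bij_betw_same_card[of "\<lambda>r. M - r"], rule bij_betw_byWitness[where f' = "\<lambda>r. M - r"])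
    show "(\<lambda>r. M - r) ` P' \<subseteq> P" "(\<lambda>r. M - r) ` P \<subseteq> P'"
      unfolding P_def P'_def using sym by force+
  qed auto
  have "C = {- M, 0, M} \<union> P \<union> uminus ` P"
  proof (intro equalityI subsetI)
    fix c assume c: "c \<in> C"
    show "c \<in> {- M, 0, M} \<union> P \<union> uminus ` P"
    proof (cases "c \<ge> 0")
      case True then show ?thesis unfolding P_def using le_M[OF c] c by force
    next
      case False
      then have "- c \<in> {M} \<union> P" unfolding P_def using ge_M[OF c] sym[OF c] by force
      then show ?thesis by force
    qed
  next
    fix c assume "c \<in> {- M, 0, M} \<union> P \<union> uminus ` P"
    then show "c \<in> C" unfolding P_def using MC zero sym by auto
  qed
  moreover have "card ({- M, 0, M} \<union> P \<union> uminus ` P) = 3 + card P + card P"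
  proof -
    have "card ({- M, 0, M} \<union> P \<union> uminus ` P) = card ({- M, 0, M} \<union> P) + card (uminus ` P)"
      by (rule card_Un_disjoint) (use finP M in \<open>auto simp: P_def\<close>)
    also have "card ({- M, 0, M} \<union> P) = card {- M, 0, M} + card P"
      by (rule card_Un_disjoint) (use finP M in \<open>auto simp: P_def\<close>)
    also have "card (uminus ` P) = card P" by (rule card_image) simp
    finally show ?thesis using M by simp
  qed
  ultimately have cP: "int (card P) = k - 1" using card by simp
  define u where "u = int (card U)"
  define v where "v = int (card V)"
  have uv: "u + v = 2 * k - 2"
    using card_Un_Int[OF finP(1,2)] cP bij unfolding u_def v_def U_def V_def by simp
  have u_ge: "u \<ge> k - 1"
    using card_mono[of U P] finP cP unfolding u_def U_def by auto
  have D3: "c - M \<in> ?D" "c \<in> ?D" "c + M \<in> ?D" if "c \<in> C" for c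
    using set_plus_intro[OF that sym[OF MC]] set_plus_intro[OF that zero] set_plus_intro[OF that MC] by simp_all
  have modU: "r \<in> {0..<M}" if "r \<in> U" for r using that unfolding U_def P_def P'_def by auto
  have modV: "r \<in> U" if "r \<in> V" for r using that unfolding U_def V_def by auto
  have fib: "\<exists>E \<subseteq> ?D. (\<forall>x\<in>E. x mod M = r) \<and>
      (if r = 0 then 5 else (if r \<in> U then 3 else 0) + (if r \<in> V then 1 else 0)) \<le> int (card E)"
    if r: "r \<in> {0..<M}" for r
  proof -
    have r2: "(r - 2 * M) mod M = r" using mod_mult_self2[of r M "- 2"] r by (simp add: mult.commute)
    consider "r = 0" | "r \<in> V" "r > 0" | "r \<in> P" "r \<notin> V" "r > 0" | "r \<in> P'" "r \<notin> V" "r > 0" | "r \<notin> U" "r > 0"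
      using r unfolding U_def by fastforce
    then show ?thesis
    proof cases
      case 1
      have "{- M - M, - M, 0, M, M + M} \<subseteq> ?D" using D3[OF MC] D3[OF sym[OF MC]] D3[OF zero] by simp
      then show ?thesis using 1 M by (intro exI[of _ "{- M - M, - M, 0, M, M + M}"]) auto
    next
      case 2
      then have "r \<in> C" "r - M \<in> C" unfolding V_def P_def P'_def by auto
      then have "{r - M - M, r - M, r, r + M} \<subseteq> ?D" using D3[of r] D3[of "r - M"] by simp
      then show ?thesis using 2 modV r r2 M
        by (intro exI[of _ "{r - M - M, r - M, r, r + M}"]) auto
    next
      case 3
      then have "{r - M, r, r + M} \<subseteq> ?D" using D3[of r] unfolding P_def by simp
      then show ?thesis using 3 r M
        by (intro exI[of _ "{r - M, r, r + M}"]) auto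
    next
      case 4
      then have "{r - M - M, r - M, r} \<subseteq> ?D" using D3[of "r - M"] unfolding P'_def by simp
      then show ?thesis using 4 r r2 M
        by (intro exI[of _ "{r - M - M, r - M, r}"]) auto
    next
      case 5
      then show ?thesis using modV[of r] by (intro exI[of _ "{}"]) auto
    qed
  qed
  have sum_ind: "(\<Sum>r\<in>{0..<M}. if r \<in> X then c else 0) = c * int (card X)" if "X \<subseteq> {0..<M}" for X and c :: int
    using that by (simp add: sum.If_cases inf.absorb2)
  have M0: "{0} \<subseteq> {0..<M}" using M by simp
  have subU: "U \<subseteq> {0..<M}" "V \<subseteq> {0..<M}" using modU modV by blast+
  have U0: "0 \<notin> U" "0 \<notin> V" unfolding U_def V_def P_def P'_def by auto
  have gsum: "(\<Sum>r\<in>{0..<M}. if r = 0 then 5 else (if r \<in> U then 3 else 0) + (if r \<in> V then 1 else (0::int)))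
      = 5 + 3 * u + v"
  proof -
    have "(\<Sum>r\<in>{0..<M}. if r = 0 then 5 else (if r \<in> U then 3 else 0) + (if r \<in> V then 1 else (0::int)))
      = (\<Sum>r\<in>{0..<M}. (if r \<in> {0} then 5 else 0) + (if r \<in> U then 3 else 0) + (if r \<in> V then 1 else 0))"
      using U0 by (intro sum.cong) auto
    then show ?thesis using sum_ind[OF M0] sum_ind[OF subU(1)] sum_ind[OF subU(2)]
      unfolding u_def v_def by (simp add: sum.distrib)
  qed
  have "5 + 3 * u + v \<le> int (card ?D)"
    using card_ge_sum_fibers[OF finD M fib] gsum by simp
  then have u_le: "20 * u \<le> 21 * k - 30" using doubling uv by linarith
  then have v_ge: "20 * v \<ge> 19 * k - 10" using uv by linarith
  have M2: "M > 1"
  proof (rule ccontr)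
    assume "\<not> ?thesis"
    then have "card U \<le> card ({}::int set)" unfolding U_def P_def P'_def by (intro card_mono) auto
    then have "u = 0" unfolding u_def by simp
    then show False using v_ge u_ge uv k by linarith
  qed
  interpret Z: modulus M by unfold_locales (rule M2)
  define W where "W = {z. z mod M \<in> insert 0 V}"
  have W: "Z.periodic W" unfolding W_def by (rule Z.periodicI) (simp add: cong_def)
  have W_V: "W \<inter> {0..<M} = insert 0 V" 
  proof -
    have "z \<in> W \<longleftrightarrow> z \<in> insert 0 V" if "z \<in> {0..<M}" for z
    proof -
      have "z mod M = z" using that by simp
      then show ?thesis by (simp only: W_def mem_Collect_eq)
    qed
    then show ?thesis using subU M by auto
  qed
  have muW: "Z.\<mu> W = v + 1" unfolding Z.\<mu>_def W_V v_def using finP U0 by simp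
  have V_sym: "M - r \<in> V" if "r \<in> V" for r
    using that sym[of r] sym[of "r - M"] unfolding V_def P_def P'_def by auto
  have W_sym: "- z \<in> W" if z: "z \<in> W" for z
  proof (cases "z mod M = 0")
    case True then show ?thesis unfolding W_def by (simp add: zmod_zminus1_eq_if)
  next
    case False
    then have "- z mod M = M - z mod M" by (simp add: zmod_zminus1_eq_if)
    then show ?thesis using z False V_sym unfolding W_def by auto
  qed
  have W_C: "z mod M \<in> C" "z mod M - M \<in> C" if "z \<in> W" for z
    using that zero sym[OF MC] unfolding W_def V_def P_def P'_def by auto
  let ?H = "W + W"
  have "(\<Sum>r\<in>{0..<M}. if r \<in> ?H \<inter> {0..<M} then 3 else 0) \<le> int (card ?D)"
  proof (rule card_ge_sum_fibers[OF finD M])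
    fix r assume r: "r \<in> {0..<M}"
    show "\<exists>E\<subseteq>?D. (\<forall>x\<in>E. x mod M = r) \<and> (if r \<in> ?H \<inter> {0..<M} then 3 else 0) \<le> int (card E)"
    proof (cases "r \<in> ?H")
      case True
      then obtain x y where xy: "x \<in> W" "y \<in> W" "r = x + y" by (auto elim: set_plus_elim)
      let ?a = "x mod M" and ?b = "y mod M"
      have "?a + ?b \<in> ?D" "?a + (?b - M) \<in> ?D" "(?a - M) + (?b - M) \<in> ?D"
        using W_C[OF xy(1)] W_C[OF xy(2)] by (blast intro: set_plus_intro)+
      moreover have "(?a + ?b) mod M = r" using xy r by (metis mod_add_eq atLeastLessThan_iff mod_pos_pos_trivial)
      moreover have "?a + (?b - M) = (?a + ?b) - M" "(?a - M) + (?b - M) = (?a + ?b) - 2 * M" by simp_all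
      moreover define c where "c = ?a + ?b"
      ultimately have "{c, c - M, c - 2 * M} \<subseteq> ?D" "c mod M = r" by simp_all
      then show ?thesis using three_translates[OF M, of c]
        by (intro exI[of _ "{c, c - M, c - 2 * M}"]) simp
    next
      case False then show ?thesis by (intro exI[of _ "{}"]) auto
    qed
  qed
  then have "3 * Z.\<mu> ?H \<le> int (card ?D)" using sum_ind[of "?H \<inter> {0..<M}" 3] unfolding Z.\<mu>_def by simp
  then have H_small: "2 * Z.\<mu> ?H < 3 * Z.\<mu> W" using doubling v_ge muW k by linarith
  have H_add: "x + y \<in> ?H" if x: "x \<in> ?H" and y: "y \<in> ?H" for x y
  proof -
    have half: "2 * Z.overlap W z > Z.\<mu> W" if z: "z \<in> ?H" for z
    proof -
      obtain a b where ab: "a \<in> W" "b \<in> W" "z = a + b" using z by (auto elim: set_plus_elim)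
      then have "a - (- b) \<in> Z.almost_periods W (Z.\<mu> (W + W) - Z.\<mu> W)"
        by (intro Z.diff_in_almost_periods[OF W] W_sym)
      then have "z \<in> Z.almost_periods W (Z.\<mu> ?H - Z.\<mu> W)" using ab by simp
      then show ?thesis using H_small unfolding Z.almost_periods_def by simp
    qed
    have "Z.overlap W (x + y) > 0" using half[OF x] half[OF y] Z.overlap_add[OF W, of x y] by linarith
    then obtain z where z: "z \<in> W" "z - (x + y) \<in> W"
      unfolding Z.overlap_def Z.\<mu>_def by (cases "W \<inter> {z. z - (x + y) \<in> W} = {}") auto
    then have "z + (- (z - (x + y))) \<in> ?H" using W_sym by (intro set_plus_intro)
    then show ?thesis by simp
  qed
  have H_neg: "- x \<in> ?H" if x: "x \<in> ?H" for x
  proof -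
    obtain a b where "a \<in> W" "b \<in> W" "x = a + b" using x by (auto elim: set_plus_elim)
    then have "- a + (- b) \<in> ?H" using W_sym by (intro set_plus_intro)
    then show ?thesis using \<open>x = a + b\<close> by simp
  qed
  have "0 \<in> W" "M \<in> W" unfolding W_def by auto
  then have W_H: "x \<in> ?H" if "x \<in> W" for x using set_plus_intro[OF that, of 0 W] by simp
  obtain q where q: "q > 0" "?H = {x. q dvd x}"
    using subgroup_int_generator[OF H_add H_neg W_H[OF \<open>M \<in> W\<close>] M] by blast
  \<comment> \<open>Otherwise the translate of \<open>W\<close> by \<open>c\<close> is disjoint from \<open>W\<close>; each of its classes has two elements of
      \<open>C + C\<close> above it, in addition to the three above each class of \<open>W\<close>.\<close>
  have C_H: "c \<in> ?H" if c: "c \<in> C" for c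
  proof (rule ccontr)
    assume cH: "c \<notin> ?H"
    let ?T = "{z. z - c \<in> W}"
    have disj: "r \<notin> W" if "r \<in> ?T" for r
    proof
      assume "r \<in> W"
      moreover have "- (r - c) \<in> W" using that by (intro W_sym) simp
      ultimately have "r + (- (r - c)) \<in> ?H" by (rule set_plus_intro)
      then show False using cH by simp
    qed
    have "(\<Sum>r\<in>{0..<M}. (if r \<in> W \<inter> {0..<M} then 3 else 0) + (if r \<in> ?T \<inter> {0..<M} then 2 else 0)) \<le> int (card ?D)"
    proof (rule card_ge_sum_fibers[OF finD M])
      fix r assume r: "r \<in> {0..<M}"
      show "\<exists>E\<subseteq>?D. (\<forall>x\<in>E. x mod M = r) \<and>
        (if r \<in> W \<inter> {0..<M} then 3 else 0) + (if r \<in> ?T \<inter> {0..<M} then 2 else 0) \<le> int (card E)"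
      proof (cases "r \<in> W")
        case True
        then have "r \<in> C" using W_C(1)[OF True] r by simp
        then have "{r - M, r, r + M} \<subseteq> ?D" using D3 by simp
        moreover have "r \<notin> ?T" using disj True by blast
        ultimately show ?thesis using True r M
          by (intro exI[of _ "{r - M, r, r + M}"]) auto
      next
        case False
        show ?thesis
        proof (cases "r \<in> ?T")
          case True
          let ?a = "(r - c) mod M"
          have "?a + c \<in> ?D" "(?a - M) + c \<in> ?D"
            using W_C[of "r - c"] True c by (blast intro: set_plus_intro)+
          moreover have "(?a + c) mod M = r" using r by (simp add: mod_add_left_eq)
          moreover have "(?a - M) + c = (?a + c) - M" by simp
          moreover define d where "d = ?a + c"
          ultimately have "{d, d - M} \<subseteq> ?D" "d mod M = r" by simp_all
          then show ?thesis using three_translates[OF M, of d] False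
            by (intro exI[of _ "{d, d - M}"]) simp
        next
          case F: False
          then show ?thesis using False by (intro exI[of _ "{}"]) auto
        qed
      qed
    qed
    then have "3 * Z.\<mu> W + 2 * Z.\<mu> ?T \<le> int (card ?D)"
      using sum_ind[of "W \<inter> {0..<M}" 3] sum_ind[of "?T \<inter> {0..<M}" 2]
      unfolding Z.\<mu>_def by (simp add: sum.distrib)
    moreover have "Z.\<mu> ?T = Z.\<mu> W" by (rule Z.mu_translate[OF W])
    ultimately show False using doubling v_ge muW k by linarith
  qed
  obtain m where m: "M = q * m" using C_H[OF MC] q by auto
  then have "m > 0" using M q by (simp add: zero_less_mult_iff)
  let ?Q = "{r \<in> {0..<M}. q dvd r}"
  have Q: "int (card ?Q) = m" unfolding m using card_multiples q \<open>m > 0\<close> by simp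
  have subQ: "insert 0 U \<subseteq> ?Q"
  proof -
    have "q dvd r" if "r \<in> U" for r
    proof -
      have "r \<in> C \<or> r - M \<in> C" using that unfolding U_def P_def P'_def by auto
      then have "q dvd r \<or> q dvd r - M" using C_H q by blast
      moreover have "q dvd M" using m by simp
      ultimately show ?thesis by (metis dvd_diff_right_iff diff_add_cancel dvd_add)
    qed
    then show ?thesis using subU M by auto
  qed
  have finQ: "finite ?Q" by (rule finite_subset[of _ "{0..<M}"]) auto
  have "card ?Q = card (insert 0 U) + card (?Q - insert 0 U)"
    using card_Un_disjoint[of "insert 0 U" "?Q - insert 0 U"] finQ finP subQ by (simp only: Un_Diff_cancel Un_absorb1) auto
  moreover have "card (insert 0 U) = Suc (card U)" using finP U0 by simp
  ultimately have R: "int (card (?Q - insert 0 U)) = m - 1 - u" using Q unfolding u_def by linarith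
  have "(\<Sum>r\<in>{0..<M}. (if r = 0 then 5 else (if r \<in> U then 3 else 0) + (if r \<in> V then 1 else 0))
      + (if r \<in> ?Q - insert 0 U then 1 else 0)) \<le> int (card ?D)"
  proof (rule card_ge_sum_fibers[OF finD M])
    fix r assume r: "r \<in> {0..<M}"
    show "\<exists>E\<subseteq>?D. (\<forall>x\<in>E. x mod M = r) \<and>
        (if r = 0 then 5 else (if r \<in> U then 3 else 0) + (if r \<in> V then 1 else 0))
      + (if r \<in> ?Q - insert 0 U then 1 else 0) \<le> int (card E)"
    proof (cases "r \<in> ?Q - insert 0 U")
      case True
      then have "r \<in> ?H" using q by simp
      then obtain x y where xy: "x \<in> W" "y \<in> W" "r = x + y" by (auto elim: set_plus_elim)
      then have "x mod M + y mod M \<in> ?D" using W_C by (blast intro: set_plus_intro)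
      moreover have "(x mod M + y mod M) mod M = r"
        using xy r by (metis mod_add_eq atLeastLessThan_iff mod_pos_pos_trivial)
      ultimately show ?thesis using True modV[of r]
        by (intro exI[of _ "{x mod M + y mod M}"]) auto
    next
      case False show ?thesis unfolding if_not_P[OF False] add_0_right by (rule fib[OF r])
    qed
  qed
  moreover have "(\<Sum>r\<in>{0..<M}. if r \<in> ?Q - insert 0 U then 1 else 0) = m - 1 - u"
  proof -
    have "?Q - insert 0 U \<subseteq> {0..<M}" by auto
    from sum_ind[OF this, of 1] R show ?thesis by (simp only: mult_1)
  qed
  ultimately have "5 + 3 * u + v + (m - 1 - u) \<le> int (card ?D)"
    by (simp only: sum.distrib gsum)
  then have m_le: "10 * m \<le> 11 * k" using u_ge uv doubling by linarith
  show thesis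
  proof (rule that[OF q(1)])
    show "q dvd c" if "c \<in> C" for c using C_H[OF that] q by blast
    show "10 * \<bar>c\<bar> \<le> 11 * k * q" if "c \<in> C" for c
    proof -
      have "10 * \<bar>c\<bar> \<le> 10 * M" using le_M[OF that] ge_M[OF that] by simp
      also have "\<dots> = (10 * m) * q" using m by simp
      also have "\<dots> \<le> (11 * k) * q" using m_le q by (intro mult_right_mono) auto
      finally show ?thesis .
    qed
  qed
qed

section \<open>A dilate that avoids the middle interval\<close>

lemma card_symmetric_odd:
  fixes C :: "int set"
  assumes "finite C" "\<And>c. c \<in> C \<Longrightarrow> - c \<in> C" "0 \<in> C"
  obtains k where "int (card C) = 2 * k + 1"
proof -
  define P where "P = C \<inter> {0<..}"
  have "C = insert 0 (P \<union> uminus ` P)"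
  proof (intro equalityI subsetI)
    fix c assume c: "c \<in> C"
    then show "c \<in> insert 0 (P \<union> uminus ` P)"
      using assms(2)[OF c] unfolding P_def by (cases "c > 0"; cases "c = 0") (force intro: image_eqI[of _ _ "- c"])+
  qed (use assms in \<open>auto simp: P_def\<close>)
  moreover have "card (insert 0 (P \<union> uminus ` P)) = 1 + card (P \<union> uminus ` P)"
    using assms(1) by (subst card_insert_disjoint) (auto simp: P_def)
  moreover have "card (P \<union> uminus ` P) = card P + card (uminus ` P)"
    using assms(1) by (intro card_Un_disjoint) (auto simp: P_def)
  moreover have "card (uminus ` P) = card P" by (rule card_image) simp
  ultimately show thesis using that[of "int (card P)"] by simp
qed

text \<open>
Pigeonhole: for \<open>x \<ge> 0\<close>, the set \<open>C\<close> and its reflection \<open>x - C\<close> are too large to be disjoint inside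
\<open>{-M..M + x}\<close>.
\<close>

lemma interval_subset_plus:
  fixes C :: "int set"
  assumes C: "C \<subseteq> {- M..M}" "int (card C) = 2 * k + 1" and sym: "\<And>c. c \<in> C \<Longrightarrow> - c \<in> C"
    and x: "\<bar>x\<bar> \<le> 4 * k - 2 * M"
  shows "x \<in> C + C"
proof -
  have finC: "finite C" using C(1) by (rule finite_subset) simp
  have nonneg: "y \<in> C + C" if y: "0 \<le> y" "y \<le> 4 * k - 2 * M" for y
  proof -
    let ?T = "(\<lambda>c. y - c) ` C"
    have "card ?T = card C" by (rule card_image) (simp add: inj_on_def)
    have "C \<inter> ?T \<noteq> {}"
    proof
      assume "C \<inter> ?T = {}"
      then have "card (C \<union> ?T) = 2 * card C"
        using card_Un_disjoint[OF finC, of ?T] finC \<open>card ?T = card C\<close> by simp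
      moreover have "card (C \<union> ?T) \<le> card {- M..M + y}"
        using C(1) y by (intro card_mono) force+
      ultimately have "int (2 * card C) \<le> int (card {- M..M + y})" by (simp only: of_nat_le_iff)
      then have "4 * k + 2 \<le> int (card {- M..M + y})" using C(2) by simp
      moreover have "card C > 0" using C(2) finC by (cases "card C") presburger+
      then have "M \<ge> 0" using C(1) by (cases "M \<ge> 0") auto
      ultimately show False using y by simp
    qed
    then obtain a b where ab: "a \<in> C" "b \<in> C" "a = y - b" by blast
    then show ?thesis using set_plus_intro[OF ab(1,2)] by simp
  qed
  show ?thesis
  proof (cases "0 \<le> x")
    case True then show ?thesis using nonneg x by simp
  next
    case False
    then have "- x \<in> C + C" using nonneg[of "- x"] x by simp
    then obtain a b where ab: "a \<in> C" "b \<in> C" "- x = a + b" by (auto elim: set_plus_elim)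
    have "x = - a + (- b)" using ab(3) by simp
    then show ?thesis using set_plus_intro[OF sym[OF ab(1)] sym[OF ab(2)]] by simp
  qed
qed

context prime_modulus begin

text \<open>
An integer of absolute value at most \<open>n * L\<close> is a sum of \<open>n\<close> integers of absolute value at most \<open>L\<close>.
\<close>

lemma almost_periods_interval_mult:
  assumes S: "periodic S" and L: "L \<ge> 0" and base: "\<And>x. \<bar>x\<bar> \<le> L \<Longrightarrow> e * x \<in> almost_periods S k"
    and "\<bar>y\<bar> \<le> int n * L"
  shows "e * y \<in> almost_periods S (int n * k)"
  using assms(4)
proof (induction n arbitrary: y)
  case 0 then show ?case by (simp add: almost_periods_0)
next
  case (Suc n)
  define x where "x = max (- L) (min L y)"
  have "\<bar>x\<bar> \<le> L" using L unfolding x_def by auto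
  moreover have "\<bar>y - x\<bar> \<le> int n * L"
  proof -
    have "0 \<le> int n * L" using L by simp
    moreover have "\<bar>y\<bar> \<le> int n * L + L" using Suc.prems by (simp add: algebra_simps)
    ultimately show ?thesis unfolding x_def by (auto simp: max_def min_def)
  qed
  ultimately have "e * x + e * (y - x) \<in> almost_periods S (k + int n * k)"
    using base Suc.IH by (intro almost_periods_add[OF S]) auto
  then show ?case by (simp add: algebra_simps)
qed

text \<open>
The numerical constants leave a comfortable margin: an exact interval would give almost-periods up to
about \<open>p/3\<close>, and only \<open>p/4\<close> is claimed. The factor \<open>10^21\<close> pays for the descent, which multiplies the
excess \<open>2 * t\<close> by \<open>2^27\<close> and ends with a set of size at least \<open>\<mu> S / 10^8\<close>, while the excess is to be at
most a thousandth of that size.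
\<close>

lemma exists_dilation_avoiding_middle:
  assumes S: "periodic S" and sf: "\<And>a b. a \<in> S \<Longrightarrow> b \<in> S \<Longrightarrow> a + b \<notin> S"
    and t: "t \<ge> 1" "p = 3 * \<mu> S + 2 * t - 1" "10^21 * t \<le> p"
  obtains e where "\<not> p dvd e" "\<And>y. 4 * \<bar>y\<bar> \<le> p \<Longrightarrow> e * y \<notin> S"
proof -
  define s where "s = \<mu> S"
  have p: "p = 3 * s + 2 * t - 1" using t unfolding s_def by simp
  have p_t: "1000000000000000000000 * t \<le> p" using t by simp
  then have p_large: "p \<ge> 1000000000000000000000" using t by simp
  have ps: "3 * s \<le> p" "1000 * p \<le> 3001 * s" using p t p_t by auto
  have s_large: "s \<ge> 100000000000000000000" using ps p_large by simp
  have Sne: "S \<noteq> {}" using s_large unfolding s_def \<mu>_def by (cases "S = {}") auto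
  have "(S + S) \<inter> S = {}" using sf by (auto elim!: set_plus_elim)
  then have SS: "\<mu> (S + S) \<le> 2 * \<mu> S + 2 * t - 1"
    using mu_Un_Int[of "S + S" S] mu_le[of "S + S \<union> S"] p unfolding s_def by (simp add: \<mu>_def)
  \<comment> \<open>The number of steps is chosen so that \<open>2000 * 3^27 \<le> 4^27\<close>.\<close>
  obtain A where A: "periodic A" "2000 * \<mu> A \<le> s \<or> 4^27 * \<mu> A \<le> 3^27 * s" "s \<le> 10^8 * \<mu> A"
    "\<mu> (A + S) - \<mu> A - s + 1 \<le> 2^27 * (2 * t)"
    using exists_small_set_small_excess[OF S SS, of 27] t ps s_large unfolding s_def by auto
  define a where "a = \<mu> A"
  have a_small: "2000 * a \<le> s" using A(2) s_large unfolding a_def by auto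
  have a_large: "s \<le> 100000000 * a" using A(3) unfolding a_def by simp
  have a_big: "a \<ge> 1000000000000" using a_large s_large by simp
  have "A \<noteq> {}" using a_big unfolding a_def \<mu>_def by (cases "A = {}") auto
  \<comment> \<open>An upper bound for \<open>\<mu> (A + S) - \<mu> S\<close> that depends only on the size of \<open>A\<close>.\<close>
  define k where "k = 1001 * a div 1000"
  have k: "1000 * k \<le> 1001 * a" "a \<le> k" "1000 * k + 999 \<ge> 1001 * a" unfolding k_def using a_big by simp_all
  have kA: "\<mu> (A + S) - \<mu> S \<le> k"
  proof -
    have "1000 * (2^27 * (2 * t)) \<le> a" using a_large ps p_t by simp
    then have "1000 * (\<mu> (A + S) - \<mu> S) \<le> 1001 * a" using A(4) unfolding a_def s_def by simp
    then show ?thesis unfolding k_def by simp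
  qed
  define n where "n = \<mu> (almost_periods S k)"
  have n: "n \<ge> 2 * a - 1"
  proof -
    have "\<mu> (A + S) - \<mu> S < \<mu> S" using kA k a_small a_big unfolding s_def by linarith
    then have "\<mu> (almost_periods S (\<mu> (A + S) - \<mu> S)) \<ge> 2 * \<mu> A - 1"
      using mu_almost_periods_ge[OF S Sne sf A(1) \<open>A \<noteq> {}\<close>] by blast
    then show ?thesis using mu_mono[OF almost_periods_mono[OF kA, of S]] unfolding n_def a_def by linarith
  qed
  \<comment> \<open>The largest number of summands for which \<open>h * (2 * k)\<close> stays below \<open>s\<close>.\<close>
  define h where "h = nat ((s - 1) div (2 * k))"
  have k0: "2 * k > 0" using k a_big by linarith
  have h: "int h * (2 * k) \<le> s - 1" "s - 1 - 2 * k \<le> int h * (2 * k)"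
  proof -
    have h': "int h = (s - 1) div (2 * k)" unfolding h_def using s_large k0 by (simp add: pos_imp_zdiv_nonneg_iff)
    have "(s - 1) = int h * (2 * k) + (s - 1) mod (2 * k)" unfolding h' by (simp only: div_mult_mod_eq)
    moreover have "0 \<le> (s - 1) mod (2 * k)" "(s - 1) mod (2 * k) < 2 * k" using k0 by simp_all
    ultimately show "int h * (2 * k) \<le> s - 1" "s - 1 - 2 * k \<le> int h * (2 * k)" by linarith+
  qed
  have h998: "998 * s \<le> 1000 * (int h * (2 * k))" 
  proof -
    have "998 * s \<le> 1000 * (s - 1 - 2 * k)" using k a_small s_large by auto
    also have "\<dots> \<le> 1000 * (int h * (2 * k))" using h(2) by (rule mult_left_mono) simp
    finally show ?thesis .
  qed
  \<comment> \<open>The \<open>h\<close>-fold sumset of \<open>N\<^bsub>2k\<^esub>\<close> still misses \<open>S\<close>, which bounds its size by about \<open>2 * s\<close>; by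
    Cauchy-Davenport a single summand has about a fraction \<open>1 / h\<close> of this.\<close>
  have n2: "998 * (\<mu> (almost_periods S (2 * k)) - 1) \<le> 4002 * k"
  proof -
    let ?m = "\<mu> (almost_periods S (2 * k)) - 1"
    have m0: "?m \<ge> 0" using mu_pos[OF periodic_almost_periods[OF S] almost_periods_0[of "2 * k" S]] k0 by linarith
    have "int h * ?m + 1 \<le> \<mu> (almost_periods S (int h * (2 * k)))"
      by (rule mu_almost_periods_mult[OF S sf]) (use k0 h s_def in auto)
    also have "\<dots> \<le> p - \<mu> S" by (rule mu_almost_periods_le[OF sf]) (use h s_def in auto)
    finally have "int h * ?m \<le> 2 * s + 2 * t" using p unfolding s_def by linarith
    then have "1000 * (int h * ?m) \<le> 2001 * s" using p_t ps by simp
    then have "(1000 * (int h * ?m)) * (2 * k) \<le> (2001 * s) * (2 * k)" using k0 by (intro mult_right_mono) auto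
    moreover have "(998 * s) * ?m \<le> (1000 * (int h * (2 * k))) * ?m" using h998 m0 by (rule mult_right_mono)
    moreover have "(1000 * (int h * ?m)) * (2 * k) = (1000 * (int h * (2 * k))) * ?m" by simp
    moreover have "(998 * s) * ?m = s * (998 * ?m)" "(2001 * s) * (2 * k) = s * (4002 * k)" by simp_all
    ultimately have "s * (998 * ?m) \<le> s * (4002 * k)" by linarith
    then show ?thesis using s_large by (simp add: mult_le_cancel_left)
  qed
  obtain e where e: "\<not> p dvd e"
    "\<mu> S * (p - \<mu> S) * (\<mu> (almost_periods S k) - int (card {c. 6 * \<bar>c\<bar> \<le> p \<and> e * c \<in> almost_periods S k}))
       \<le> 2 * (\<mu> (almost_periods S k) * p * k)"
    using almost_periods_concentrated[OF S, of k] s_large ps unfolding s_def by auto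
  define C where "C = {c. 6 * \<bar>c\<bar> \<le> p \<and> e * c \<in> almost_periods S k}"
  have finC: "finite C"
    by (rule finite_subset[of _ "{- p..p}"]) (auto simp: C_def)
  have C_sym: "- c \<in> C" if "c \<in> C" for c
    using that almost_periods_uminus[OF S, of "e * c" k] unfolding C_def by simp
  have C0: "0 \<in> C" unfolding C_def using almost_periods_0[of k] k0 p_gt_1 by simp
  obtain j where j: "int (card C) = 2 * j + 1" using card_symmetric_odd[OF finC C_sym C0] by blast
  \<comment> \<open>Few almost-periods lie outside \<open>[-p/6, p/6]\<close> because \<open>k\<close> is small compared with \<open>s\<close>.\<close>
  have cardC: "400 * (n - int (card C)) \<le> n"
  proof (cases "n - int (card C) \<ge> 0")
    case True
    let ?d = "n - int (card C)"
    have "s * p * ?d \<le> s * (2 * (p - s)) * ?d"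
      using True s_large ps by (intro mult_right_mono mult_left_mono) auto
    also have "\<dots> = 2 * (s * (p - s) * ?d)" by simp
    also have "\<dots> \<le> 2 * (2 * (n * p * k))" using e(2) unfolding s_def n_def C_def by linarith
    finally have "p * (s * ?d) \<le> p * (4 * (n * k))" by (simp add: ac_simps)
    then have "s * ?d \<le> 4 * (n * k)" using p_gt_1 by (simp add: mult_le_cancel_left)
    moreover have "n * (1600 * k) \<le> n * s"
      using k a_small n a_big by (intro mult_left_mono) linarith+
    moreover have "s * (400 * ?d) = 400 * (s * ?d)" "n * (1600 * k) = 400 * (4 * (n * k))" "n * s = s * n"
      by (simp_all add: algebra_simps)
    ultimately have "s * (400 * ?d) \<le> s * n" by linarith
    then show ?thesis using s_large by (simp add: mult_le_cancel_left)
  next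
    case False then show ?thesis using n a_big by auto
  qed
  have j_large: "1000 * j \<ge> 997 * a" using cardC n j a_big by auto
  \<comment> \<open>Elements of \<open>C + C\<close> have absolute value at most \<open>p/3\<close>, so they are distinct modulo \<open>p\<close>.\<close>
  have CC: "int (card (C + C)) \<le> \<mu> (almost_periods S (2 * k))"
  proof -
    have "int (card (C + C)) \<le> \<mu> {x. e * x \<in> almost_periods S (2 * k)}"
    proof (rule mu_ge_card)
      show "periodic {x. e * x \<in> almost_periods S (2 * k)}" using S by (intro periodic_affine) blast
      show "C + C \<subseteq> {x. e * x \<in> almost_periods S (2 * k)}"
        using almost_periods_add[OF S] by (force elim!: set_plus_elim simp: C_def distrib_left)
      fix x y assume "x \<in> C + C" "y \<in> C + C" and xy: "[x = y] (mod p)"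
      moreover have "3 * \<bar>z\<bar> \<le> p" if z: "z \<in> C + C" for z
      proof -
        obtain b c where "b \<in> C" "c \<in> C" "z = b + c" using z by (auto elim: set_plus_elim)
        then have "6 * \<bar>b\<bar> \<le> p" "6 * \<bar>c\<bar> \<le> p" "z = b + c" unfolding C_def by auto
        then show ?thesis by linarith
      qed
      ultimately have "3 * \<bar>x\<bar> \<le> p" "3 * \<bar>y\<bar> \<le> p" by blast+
      then have "\<bar>x - y\<bar> < p" using p_gt_1 by linarith
      moreover have "p dvd x - y" using xy by (simp add: cong_iff_dvd_diff)
      ultimately show "x = y" using dvd_imp_le_int[of "x - y" p] by fastforce
    qed
    also have "\<dots> = \<mu> (almost_periods S (2 * k))" using S e(1) by (intro mu_dilate) auto
    finally show ?thesis .
  qed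
  have doubling: "10 * int (card (C + C)) \<le> 41 * j"
    using CC n2 k j_large a_big by auto
  obtain q where q: "q > 0" "\<And>c. c \<in> C \<Longrightarrow> q dvd c" "\<And>c. c \<in> C \<Longrightarrow> 10 * \<bar>c\<bar> \<le> 11 * j * q"
    using symmetric_small_doubling[OF finC C_sym C0 j _ doubling] j_large a_big by auto
  define C' where "C' = {x. q * x \<in> C}"
  have C_C': "C = (\<lambda>x. q * x) ` C'" unfolding C'_def using q(2) by (auto elim!: dvdE)
  have cardC': "int (card C') = 2 * j + 1"
  proof -
    have "card C = card C'" unfolding C_C' by (rule card_image) (use q in \<open>auto simp: inj_on_def\<close>)
    then show ?thesis using j by simp
  qed
  define M where "M = 11 * j div 10"
  have C'M: "C' \<subseteq> {- M..M}"
  proof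
    fix x assume "x \<in> C'"
    then have "q * (10 * \<bar>x\<bar>) \<le> q * (11 * j)"
      using q(3)[of "q * x"] q(1) unfolding C'_def by (simp add: abs_mult ac_simps)
    then have "10 * \<bar>x\<bar> \<le> 11 * j" using q(1) by (simp add: mult_le_cancel_left)
    then show "x \<in> {- M..M}" unfolding M_def by auto
  qed
  define L where "L = 4 * j - 2 * M"
  have L: "1000 * L \<ge> 1780 * k" unfolding L_def M_def using j_large k a_big by auto
  have pq: "\<not> p dvd q"
  proof
    assume "p dvd q"
    have "C \<subseteq> {0}"
    proof
      fix c assume c: "c \<in> C"
      then have "p dvd c" using \<open>p dvd q\<close> q(2) dvd_trans by blast
      moreover have "\<bar>c\<bar> < p" using c p_gt_1 unfolding C_def by auto
      ultimately show "c \<in> {0}" using dvd_imp_le_int[of c p] by fastforce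
    qed
    then have "card C \<le> card {0::int}" by (intro card_mono) auto
    then show False using j j_large a_big by auto
  qed
  have base: "(e * q) * x \<in> almost_periods S (2 * k)" if x: "\<bar>x\<bar> \<le> L" for x
  proof -
    have "x \<in> C' + C'"
      by (rule interval_subset_plus[OF C'M cardC']) (use C_sym x in \<open>auto simp: C'_def L_def\<close>)
    then obtain b c where bc: "b \<in> C'" "c \<in> C'" "x = b + c" by (auto elim: set_plus_elim)
    then have "e * (q * b) + e * (q * c) \<in> almost_periods S (k + k)"
      unfolding C'_def C_def by (intro almost_periods_add[OF S]) auto
    then show ?thesis using bc(3) by (simp add: algebra_simps)
  qed
  \<comment> \<open>Here \<open>h * L\<close> is at least \<open>0.888 * s\<close>, and \<open>s\<close> is almost \<open>p / 3\<close>.\<close>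
  have hL: "p \<le> 4 * (int h * L)"
  proof -
    have "int h * (1780 * k) \<le> int h * (1000 * L)" using L by (intro mult_left_mono) auto
    then have "890 * (int h * (2 * k)) \<le> 1000 * (int h * L)" by simp
    then have "890 * (998 * s) \<le> 1000000 * (int h * L)" using h998 by linarith
    then show ?thesis using ps by linarith
  qed
  show thesis
  proof (rule that)
    show "\<not> p dvd e * q" using e(1) pq prime_p by (simp add: prime_dvd_mult_iff)
    fix y assume y: "4 * \<bar>y\<bar> \<le> p"
    have "(e * q) * y \<in> almost_periods S (int h * (2 * k))"
      by (rule almost_periods_interval_mult[OF S _ base]) (use L k0 hL y in auto)
    moreover have "almost_periods S (int h * (2 * k)) \<inter> S = {}"
      by (rule almost_periods_disjoint[OF sf]) (use h s_def in auto)
    ultimately show "(e * q) * y \<notin> S" by blast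
  qed
qed

end

section \<open>Sets inside an interval are given by special sets\<close>

context prime_modulus begin

definition sym_complete_sum_free :: "int \<Rightarrow> int set \<Rightarrow> bool" where
  "sym_complete_sum_free s X \<longleftrightarrow> periodic X \<and> (\<forall>x\<in>X. - x \<in> X) \<and> (\<forall>a\<in>X. \<forall>b\<in>X. a + b \<notin> X)
     \<and> (\<forall>z. z \<notin> X \<longrightarrow> z \<in> X + X) \<and> \<mu> X = s"

lemma sym_complete_sum_free_dilate:
  assumes X: "sym_complete_sum_free s X" and e: "\<not> p dvd e"
  shows "sym_complete_sum_free s {y. e * y \<in> X}"
proof -
  obtain e' where e': "[e * e' = 1] (mod p)" using inverse_mod_p[OF e] by blast
  have pX: "periodic X" and sym: "\<And>x. x \<in> X \<Longrightarrow> - x \<in> X" and sf: "\<And>a b. a \<in> X \<Longrightarrow> b \<in> X \<Longrightarrow> a + b \<notin> X"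
    and complete: "\<And>z. z \<notin> X \<Longrightarrow> z \<in> X + X" and mu: "\<mu> X = s"
    using X unfolding sym_complete_sum_free_def by auto
  have ee': "[e * (e' * a) = a] (mod p)" for a
    using cong_mult[OF e' cong_refl[of a]] by (simp add: mult.assoc)
  let ?Y = "{y. e * y \<in> X}"
  have "z \<in> ?Y + ?Y" if z: "z \<notin> ?Y" for z
  proof -
    have "e * z \<in> X + X" using complete z by blast
    then obtain a b where ab: "a \<in> X" "b \<in> X" "e * z = a + b" by (auto elim: set_plus_elim)
    have a: "e * (e' * a) \<in> X" using periodicD[OF pX ee'] ab(1) by blast
    have "[e * z - e * (e' * a) = e * z - a] (mod p)" by (intro cong_diff cong_refl ee')
    then have "[e * (z - e' * a) = b] (mod p)" using ab(3) by (simp add: right_diff_distrib)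
    then have b: "e * (z - e' * a) \<in> X" using periodicD[OF pX] ab(2) by blast
    have "e' * a + (z - e' * a) \<in> ?Y + ?Y" by (rule set_plus_intro) (use a b in auto)
    then show ?thesis by simp
  qed
  moreover have "- x \<in> ?Y" if "x \<in> ?Y" for x using sym[of "e * x"] that by simp
  moreover have "a + b \<notin> ?Y" if "a \<in> ?Y" "b \<in> ?Y" for a b
    using sf[of "e * a" "e * b"] that by (simp add: distrib_left)
  ultimately show ?thesis unfolding sym_complete_sum_free_def
    using periodic_affine[OF pX] mu_dilate[OF pX e] mu by blast
qed

text \<open>
Let \<open>m\<close> be the smallest nonnegative element of \<open>X\<close>; by symmetry \<open>X\<close> lies in \<open>[m, p - m]\<close>. Of the two numbers
\<open>y\<close> and \<open>y + m\<close> at most one belongs to \<open>X\<close>. Moving the elements \<open>y \<le> p - 2 * m\<close> to \<open>y + m\<close> thus maps \<open>X\<close>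
injectively into an interval of length \<open>m\<close>, where \<open>4 * m > p\<close> ensures that moved elements do land in
it. Hence \<open>s \<le> m\<close>.
\<close>

lemma sum_free_subset_interval:
  assumes X: "sym_complete_sum_free s X" and s: "s \<ge> 1" and mid: "\<And>y. 4 * \<bar>y\<bar> \<le> p \<Longrightarrow> y \<notin> X"
    and x: "x \<in> X" "0 \<le> x" "x < p"
  shows "s \<le> x" "x \<le> p - s"
proof -
  have pX: "periodic X" and sym: "\<And>x. x \<in> X \<Longrightarrow> - x \<in> X" and sf: "\<And>a b. a \<in> X \<Longrightarrow> b \<in> X \<Longrightarrow> a + b \<notin> X"
    and mu: "\<mu> X = s"
    using X unfolding sym_complete_sum_free_def by auto
  let ?X = "X \<inter> {0..<p}"
  have "?X \<noteq> {}" using x by auto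
  define m where "m = Min ?X"
  have m: "m \<in> ?X" unfolding m_def by (rule Min_in) (use \<open>?X \<noteq> {}\<close> in auto)
  have m_le: "m \<le> y" if "y \<in> ?X" for y unfolding m_def by (rule Min_le) (use that in auto)
  have "\<not> 4 * m \<le> p" using mid[of m] m by auto
  then have m4: "4 * m > p" by simp
  have le_pm: "y \<le> p - m" if y: "y \<in> ?X" for y
  proof -
    have "y \<noteq> 0" using y mid[of 0] p_gt_1 by auto
    have "- y \<in> X" using y sym by blast
    then have "p - y \<in> X" using periodicD[OF pX, of "- y" "p - y"] by (simp add: cong_iff_dvd_diff)
    then have "p - y \<in> ?X" using y \<open>y \<noteq> 0\<close> by auto
    then show ?thesis using m_le by fastforce
  qed
  define g where "g y = (if y \<le> p - 2 * m then y + m else y)" for y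
  have "inj_on g ?X"
  proof (rule inj_onI)
    fix y z assume yz: "y \<in> ?X" "z \<in> ?X" "g y = g z"
    have "y + m \<noteq> z" "z + m \<noteq> y" using sf m yz by auto
    then show "y = z" using yz(3) unfolding g_def by (auto split: if_splits)
  qed
  moreover have "g ` ?X \<subseteq> {p - 2 * m + 1..p - m}"
  proof
    fix z assume "z \<in> g ` ?X"
    then obtain y where y: "y \<in> ?X" "z = g y" by blast
    show "z \<in> {p - 2 * m + 1..p - m}" using m_le[OF y(1)] le_pm[OF y(1)] m4 m unfolding y(2) g_def by auto
  qed
  ultimately have "card ?X \<le> card {p - 2 * m + 1..p - m}" by (intro card_inj_on_le) auto
  then have "s \<le> m" using mu s unfolding \<mu>_def by simp
  then show "s \<le> x" "x \<le> p - s" using m_le[of x] le_pm[of x] x by auto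
qed

end

text \<open>
For \<open>s \<ge> 4 * t\<close> the middle part of \<open>S_set p s T\<close> is long enough for its sumset to cover the residues that
are not reached through \<open>T\<close>.
\<close>

locale special_modulus = prime_modulus +
  fixes s t :: int
  assumes p_eq: "p = 3 * s + 2 * t - 1" and t_pos: "t \<ge> 1" and s_ge: "s \<ge> 4 * t"
begin

lemma S_set_eq:
  assumes T: "T \<subseteq> {0..2 * t - 1}"
  shows "S_set p s T = {s + 2 * t..2 * s - 1} \<union> (\<lambda>x. s + x) ` T \<union> (\<lambda>x. p - s - x) ` T"
proof -
  interpret R: residues p "residue_ring p" by unfold_locales (rule p_gt_1)
  have res: "residues_of p Y = Y" if "Y \<subseteq> {0..<p}" for Y
    using that unfolding residues_of_def by (force simp: image_iff)
  have 1: "residues_of p {p - 2 * s + 1..2 * s - 1} = {s + 2 * t..2 * s - 1}"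
  proof -
    have eq: "p - 2 * s + 1 = s + 2 * t" using p_eq by simp
    show ?thesis unfolding eq by (rule res) (use p_eq t_pos s_ge in auto)
  qed
  have sub: "(\<lambda>x. s + x) ` T \<subseteq> {0..<p}" using T p_eq t_pos s_ge by auto
  have 2: "residues_of p ((\<lambda>x. s + x) ` T) = (\<lambda>x. s + x) ` T" by (rule res[OF sub])
  have "a_set_inv\<^bsub>residue_ring p\<^esub> ((\<lambda>x. s + x) ` T) = (\<lambda>x. (- (s + x)) mod p) ` T"
    unfolding A_SET_INV_def' R.res_neg_eq by auto
  also have "\<dots> = (\<lambda>x. p - s - x) ` T"
  proof (rule image_cong[OF refl])
    fix x assume "x \<in> T"
    then have "0 < s + x" "s + x < p" using T p_eq t_pos s_ge by force+
    then have "(- (s + x)) mod p = (p - (s + x)) mod p" by (metis minus_mod_self2 uminus_add_conv_diff add.commute mod_add_self1)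
    also have "\<dots> = p - (s + x)" using \<open>0 < s + x\<close> \<open>s + x < p\<close> by (intro mod_pos_pos_trivial) auto
    finally show "(- (s + x)) mod p = p - s - x" by simp
  qed
  finally show ?thesis unfolding S_set_def plus_minus_def 1 2 by auto
qed

lemma S_set_iff:
  assumes T: "T \<subseteq> {0..2 * t - 1}"
  shows "x \<in> S_set p s T \<longleftrightarrow> s + 2 * t \<le> x \<and> x \<le> 2 * s - 1 \<or> x - s \<in> T \<or> p - s - x \<in> T"
proof -
  have "x \<in> (\<lambda>x. s + x) ` T \<longleftrightarrow> x - s \<in> T" by force
  moreover have "x \<in> (\<lambda>x. p - s - x) ` T \<longleftrightarrow> p - s - x \<in> T" by force
  ultimately show ?thesis unfolding S_set_eq[OF T] by auto
qed

lemma S_set_bounds: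
  assumes T: "T \<subseteq> {0..2 * t - 1}" and x: "x \<in> S_set p s T"
  shows "s \<le> x" "x \<le> p - s"
  using x T p_eq t_pos s_ge unfolding S_set_iff[OF T] by (auto dest!: subsetD[OF T])

lemma card_S_set:
  assumes T: "T \<subseteq> {0..2 * t - 1}"
  shows "int (card (S_set p s T)) = s - 2 * t + 2 * int (card T)"
proof -
  have fin: "finite T" using T by (rule finite_subset) simp
  have "card (S_set p s T) = card ({s + 2 * t..2 * s - 1} \<union> (\<lambda>x. s + x) ` T) + card ((\<lambda>x. p - s - x) ` T)"
    unfolding S_set_eq[OF T]
    by (rule card_Un_disjoint) (use fin T p_eq t_pos s_ge in \<open>auto dest!: subsetD[OF T]\<close>)
  also have "card ({s + 2 * t..2 * s - 1} \<union> (\<lambda>x. s + x) ` T) = card {s + 2 * t..2 * s - 1} + card ((\<lambda>x. s + x) ` T)"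
    by (rule card_Un_disjoint) (use fin T p_eq t_pos s_ge in \<open>auto dest!: subsetD[OF T]\<close>)
  also have "card ((\<lambda>x. s + x) ` T) = card T" by (rule card_image) simp
  also have "card ((\<lambda>x. p - s - x) ` T) = card T" by (rule card_image) (simp add: inj_on_def)
  finally show ?thesis using s_ge t_pos by simp
qed

text \<open>
Two elements of \<open>[s, p - s]\<close> have a sum in \<open>[2 * s, p + s + 2 * t - 1]\<close>, which modulo \<open>p\<close> misses
\<open>[s + 2 * t, 2 * s - 1]\<close>; completeness therefore puts this middle part into \<open>X\<close>. Comparison of
cardinalities gives \<open>card T = t\<close>. As \<open>3 * s + (2 * t - 1) = p\<close>, three elements of \<open>T\<close> with sum
\<open>2 * t - 1\<close> would give three elements of \<open>X\<close> with sum \<open>p\<close>. The last condition on \<open>T\<close> is completeness at the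
points \<open>2 * s + u\<close>, which can only be sums of two elements of \<open>s + T\<close>.
\<close>

lemma subset_interval_imp_S_set:
  assumes X: "sym_complete_sum_free s X" and int: "\<And>x. x \<in> X \<Longrightarrow> 0 \<le> x \<Longrightarrow> x < p \<Longrightarrow> s \<le> x \<and> x \<le> p - s"
  obtains T where "special t T" "X \<inter> {0..<p} = S_set p s T"
proof -
  have pX: "periodic X" and sym: "\<And>x. x \<in> X \<Longrightarrow> - x \<in> X" and sf: "\<And>a b. a \<in> X \<Longrightarrow> b \<in> X \<Longrightarrow> a + b \<notin> X"
    and complete: "\<And>z. z \<notin> X \<Longrightarrow> z \<in> X + X" and mu: "\<mu> X = s"
    using X unfolding sym_complete_sum_free_def by auto
  have sym': "p - x \<in> X \<longleftrightarrow> x \<in> X" for x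
  proof -
    have "p - x \<in> X \<longleftrightarrow> - x \<in> X" by (rule periodicD[OF pX]) (simp add: cong_iff_dvd_diff)
    then show ?thesis using sym[of x] sym[of "- x"] by auto
  qed
  have split: "\<exists>a b j. a \<in> X \<and> b \<in> X \<and> s \<le> a \<and> a \<le> p - s \<and> s \<le> b \<and> b \<le> p - s \<and> a + b = z + p * j"
    if z: "z \<notin> X" for z
  proof -
    obtain a b where ab: "a \<in> X" "b \<in> X" "z = a + b" using complete[OF z] by (auto elim: set_plus_elim)
    have "a mod p \<in> X" "b mod p \<in> X" using ab periodic_mod[OF pX] by auto
    moreover have "0 \<le> a mod p" "a mod p < p" "0 \<le> b mod p" "b mod p < p" using p_gt_1 by simp_all
    moreover have "a mod p + b mod p = z + p * (- (a div p) - (b div p))"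
      using ab(3) by (simp add: algebra_simps minus_mult_div_eq_mod[symmetric])
    ultimately show ?thesis using int by blast
  qed
  define T where "T = {x \<in> {0..2 * t - 1}. s + x \<in> X}"
  have T: "T \<subseteq> {0..2 * t - 1}" unfolding T_def by auto
  have middle: "z \<in> X" if z: "s + 2 * t \<le> z" "z \<le> 2 * s - 1" for z
  proof (rule ccontr)
    assume "z \<notin> X"
    then obtain a b j where ab: "s \<le> a" "a \<le> p - s" "s \<le> b" "b \<le> p - s" "a + b = z + p * j"
      using split by blast
    have "j \<ge> 1"
    proof (rule ccontr)
      assume "\<not> j \<ge> 1"
      then have "p * j \<le> 0" using p_gt_1 by (simp add: mult_le_0_iff)
      then show False using ab z by linarith
    qed
    then have "p * 1 \<le> p * j" using p_gt_1 by (intro mult_left_mono) auto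
    then show False using ab z p_eq by linarith
  qed
  have X_eq: "X \<inter> {0..<p} = S_set p s T"
  proof (intro equalityI subsetI)
    fix x assume x: "x \<in> X \<inter> {0..<p}"
    then have b: "s \<le> x" "x \<le> p - s" using int by auto
    consider "x \<le> s + 2 * t - 1" | "s + 2 * t \<le> x" "x \<le> 2 * s - 1" | "2 * s \<le> x" by linarith
    then show "x \<in> S_set p s T"
    proof cases
      case 1
      then have "x - s \<in> T" using x b unfolding T_def by simp
      then show ?thesis unfolding S_set_iff[OF T] by blast
    next
      case 2 then show ?thesis unfolding S_set_iff[OF T] by blast
    next
      case 3
      moreover have "s + (p - s - x) \<in> X" using x sym'[of x] by simp
      moreover have "p - s - x \<le> 2 * t - 1" using 3 p_eq by simp
      ultimately have "p - s - x \<in> T" using b unfolding T_def by simp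
      then show ?thesis unfolding S_set_iff[OF T] by blast
    qed
  next
    fix x assume x: "x \<in> S_set p s T"
    then have "0 \<le> x" "x < p" using S_set_bounds[OF T x] s_ge t_pos by auto
    moreover have "x \<in> X"
    proof -
      consider "s + 2 * t \<le> x" "x \<le> 2 * s - 1" | "x - s \<in> T" | "p - s - x \<in> T"
        using x unfolding S_set_iff[OF T] by blast
      then show ?thesis
      proof cases
        case 1 then show ?thesis by (rule middle)
      next
        case 2 then show ?thesis unfolding T_def by simp
      next
        case 3
        then have "p - x \<in> X" unfolding T_def by simp
        then show ?thesis using sym' by blast
      qed
    qed
    ultimately show "x \<in> X \<inter> {0..<p}" by simp
  qed
  have cardT: "int (card T) = t"
    using card_S_set[OF T] mu unfolding \<mu>_def X_eq by simp
  have finT: "finite T" using T by (rule finite_subset) simp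
  have neT: "T \<noteq> {}" using cardT t_pos by auto
  have min: "Min T \<in> T" "\<And>x. x \<in> T \<Longrightarrow> Min T \<le> x" using finT neT by auto
  have min_b: "0 \<le> Min T" "Min T \<le> 2 * t - 1" using min(1) T by auto
  have lower: "s + Min T \<le> a" if a: "a \<in> X" "s \<le> a" "a \<le> p - s" for a
  proof (cases "a - s \<in> T")
    case True then show ?thesis using min(2) by fastforce
  next
    case False
    then have "a - s > 2 * t - 1" using a unfolding T_def by auto
    then show ?thesis using min_b by linarith
  qed
  have "2 * t - 1 \<notin> T + T + T"
  proof
    assume "2 * t - 1 \<in> T + T + T"
    then obtain x y z where xyz: "x \<in> T" "y \<in> T" "z \<in> T" "2 * t - 1 = x + y + z"
      by (auto elim!: set_plus_elim)
    then have "(s + x) + (s + y) \<notin> X" using sf unfolding T_def by blast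
    moreover have "(s + x) + (s + y) = p - (s + z)" using p_eq xyz(4) by simp
    ultimately show False using sym'[of "s + z"] xyz(3) unfolding T_def by simp
  qed
  moreover have "u \<in> T + T" if u: "u \<in> {0..2 * t - 1 + Min T}" "u \<notin> (\<lambda>x. 2 * t - 1 - x) ` T" for u
  proof -
    have ub: "0 \<le> u" "u \<le> 2 * t - 1 + Min T" using u(1) by auto
    have "2 * s + u \<notin> X"
    proof
      assume uX: "2 * s + u \<in> X"
      show False
      proof (cases "u \<le> 2 * t - 1")
        case True
        have eq: "p - (2 * s + u) = s + (2 * t - 1 - u)" using p_eq by simp
        have "p - (2 * s + u) \<in> X" using sym' uX by blast
        then have "2 * t - 1 - u \<in> T" using True ub unfolding eq T_def by simp
        then have "2 * t - 1 - (2 * t - 1 - u) \<in> (\<lambda>x. 2 * t - 1 - x) ` T" by blast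
        then show False using u(2) by simp
      next
        case False
        then have "2 * s + u \<le> p - s" using int[OF uX] ub min_b s_ge t_pos p_eq by linarith
        then show False using False p_eq by linarith
      qed
    qed
    then obtain a b j where ab: "a \<in> X" "b \<in> X" "s \<le> a" "a \<le> p - s" "s \<le> b" "b \<le> p - s"
      "a + b = 2 * s + u + p * j" using split by blast
    have "j = 0"
    proof (rule ccontr)
      assume "j \<noteq> 0"
      then consider "j \<ge> 1" | "j \<le> - 1" by linarith
      then show False
      proof cases
        case 1
        then have "p * 1 \<le> p * j" using p_gt_1 by (intro mult_left_mono) auto
        then show False using ab ub p_eq s_ge t_pos by linarith
      next
        case 2
        then have "p * j \<le> p * (- 1)" using p_gt_1 by (intro mult_left_mono) auto
        then show False using ab ub min_b p_eq s_ge t_pos by linarith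
      qed
    qed
    then have "a - s \<in> T" "b - s \<in> T"
      using ab ub lower[of a] lower[of b] unfolding T_def by auto
    then have "(a - s) + (b - s) \<in> T + T" by (rule set_plus_intro)
    then show ?thesis using ab(7) \<open>j = 0\<close> by simp
  qed
  ultimately have "special t T" unfolding special_def using T cardT by blast
  then show thesis using that X_eq by blast
qed

text \<open>
Three elements of \<open>S_set p s T\<close> whose sum is divisible by \<open>p\<close> have sum \<open>p\<close> or \<open>2 * p\<close>, and the second case is
the mirror image of the first. Sum \<open>p\<close> forces all three into \<open>s + T\<close>, against the second condition on \<open>T\<close>. For
completeness it suffices, again by symmetry, to reach the missing points \<open>2 * s + u\<close> up to \<open>p\<close>: small \<open>u\<close> are
covered by \<open>T + T\<close>, medium ones by \<open>Min T\<close> plus the middle part, and large ones by the middle part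
alone.
\<close>

lemma sym_complete_sum_free_S_set:
  assumes T: "special t T"
  shows "sym_complete_sum_free s {x. x mod p \<in> S_set p s T}"
proof -
  let ?S = "S_set p s T"
  have sub: "T \<subseteq> {0..2 * t - 1}" and cardT: "int (card T) = t" and no3: "2 * t - 1 \<notin> T + T + T"
    and cover: "{0..2 * t - 1 + Min T} - (\<lambda>x. 2 * t - 1 - x) ` T \<subseteq> T + T"
    using T unfolding special_def by auto
  have finT: "finite T" using sub by (rule finite_subset) simp
  have neT: "T \<noteq> {}" using cardT t_pos by auto
  have min: "Min T \<in> T" using finT neT by auto
  have min_b: "0 \<le> Min T" "Min T \<le> 2 * t - 1" using min sub by auto
  note iff = S_set_iff[OF sub] and bounds = S_set_bounds[OF sub]
  have sym: "p - x \<in> ?S" if x: "x \<in> ?S" for x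
  proof -
    have "p - s - (p - x) = x - s" "(p - x) - s = p - s - x" by simp_all
    moreover have "s + 2 * t \<le> p - x \<longleftrightarrow> x \<le> 2 * s - 1" "p - x \<le> 2 * s - 1 \<longleftrightarrow> s + 2 * t \<le> x"
      using p_eq by auto
    ultimately show ?thesis using x unfolding iff by metis
  qed
  have low: "x - s \<in> T" if "x \<in> ?S" "x \<le> s + 2 * t - 1" for x
    using that p_eq t_pos s_ge unfolding iff by (auto dest: subsetD[OF sub])
  have no_p: "x + y + z \<noteq> p" if S: "x \<in> ?S" "y \<in> ?S" "z \<in> ?S" for x y z
  proof
    assume xyz: "x + y + z = p"
    have "x - s \<in> T" "y - s \<in> T" "z - s \<in> T"
      using low S bounds(1)[OF S(1)] bounds(1)[OF S(2)] bounds(1)[OF S(3)] xyz p_eq by auto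
    then have "(x - s) + (y - s) + (z - s) \<in> T + T + T" by (intro set_plus_intro)
    moreover have "(x - s) + (y - s) + (z - s) = 2 * t - 1" using xyz p_eq by simp
    ultimately show False using no3 by simp
  qed
  let ?X = "{x. x mod p \<in> ?S}"
  have in_range: "0 < x \<and> x < p" if "x \<in> ?S" for x using bounds[OF that] s_ge t_pos by auto
  have S_X: "x \<in> ?X" if "x \<in> ?S" for x using in_range[OF that] that by simp
  have neg: "- x \<in> ?X" if x: "x \<in> ?X" for x
  proof -
    have "p - x mod p \<in> ?S" using x sym by blast
    moreover from in_range[OF this] have "(p - x mod p) mod p = p - x mod p"
      by (intro mod_pos_pos_trivial) auto
    moreover have "(- x) mod p = (p - x mod p) mod p" by (simp add: mod_simps)
    ultimately show ?thesis by simp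
  qed
  have sf: "a + b \<notin> ?X" if a: "a \<in> ?X" and b: "b \<in> ?X" for a b
  proof
    assume "a + b \<in> ?X"
    then have "(- (a + b)) mod p \<in> ?S" using neg by blast
    then obtain x y z where xyz: "x = a mod p" "y = b mod p" "z = (- (a + b)) mod p" "x \<in> ?S" "y \<in> ?S" "z \<in> ?S"
      using a b by blast
    have "[x + y + z = a + b + (- (a + b))] (mod p)" unfolding xyz by (intro cong_add) auto
    then have "(x + y + z) mod p = 0" by (simp add: cong_def)
    then obtain j where j: "x + y + z = p * j" by auto
    have lo: "3 * s \<le> p * j" and hi: "p * j \<le> 3 * p - 3 * s"
      using bounds[OF xyz(4)] bounds[OF xyz(5)] bounds[OF xyz(6)] j by linarith+
    have "p * j > 0" using lo s_ge t_pos by linarith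
    then have "j > 0" using p_gt_1 by (simp add: zero_less_mult_iff)
    moreover have "p * j < p * 3" using hi s_ge t_pos by linarith
    then have "j < 3" using p_gt_1 by simp
    ultimately consider "j = 1" | "j = 2" by linarith
    then show False
    proof cases
      case 1 then show False using no_p[OF xyz(4-6)] j by simp
    next
      case 2
      then have "(p - x) + (p - y) + (p - z) = p" using j by simp
      then show False using no_p[OF sym[OF xyz(4)] sym[OF xyz(5)] sym[OF xyz(6)]] by simp
    qed
  qed
  have upper: "\<exists>a\<in>?S. \<exists>b\<in>?S. a + b = z" if z: "z \<notin> ?S" "2 * s \<le> z" "z \<le> p" for z
  proof -
    define u where "u = z - 2 * s"
    have u: "0 \<le> u" "u \<le> s + 2 * t - 1" using z p_eq unfolding u_def by auto
    consider "u \<le> 2 * t - 1 + Min T" | "u > 2 * t - 1 + Min T" "u - Min T \<le> s - 1" | "u - Min T > s - 1"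
      by linarith
    then show ?thesis
    proof cases
      case 1
      have "u \<notin> (\<lambda>x. 2 * t - 1 - x) ` T"
      proof
        assume "u \<in> (\<lambda>x. 2 * t - 1 - x) ` T"
        then obtain x where x: "x \<in> T" "u = 2 * t - 1 - x" by blast
        then have "p - s - z = x" using p_eq unfolding u_def by linarith
        then show False using z(1) x(1) unfolding iff by blast
      qed
      then have "u \<in> T + T" using cover 1 u by auto
      then obtain x y where "x \<in> T" "y \<in> T" "u = x + y" by (auto elim: set_plus_elim)
      then show ?thesis by (intro bexI[of _ "s + x"] bexI[of _ "s + y"]) (auto simp: iff u_def)
    next
      case 2
      then show ?thesis using min
        by (intro bexI[of _ "s + Min T"] bexI[of _ "s + (u - Min T)"]) (auto simp: iff u_def)
    next
      case 3
      then show ?thesis using u min_b s_ge t_pos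
        by (intro bexI[of _ "s + 2 * t"] bexI[of _ "s + (u - 2 * t)"]) (auto simp: iff u_def)
    qed
  qed
  have complete: "z \<in> ?X + ?X" if z: "z \<notin> ?X" for z
  proof -
    let ?z = "z mod p"
    have zb: "0 \<le> ?z" "?z < p" using p_gt_1 by simp_all
    have zS: "?z \<notin> ?S" using z by simp
    have "\<exists>a\<in>?S. \<exists>b\<in>?S. [a + b = z] (mod p)"
    proof (cases "2 * s \<le> ?z")
      case True
      then obtain a b where ab: "a \<in> ?S" "b \<in> ?S" "a + b = ?z" using upper[OF zS] zb by auto
      then have "[a + b = z] (mod p)" by (simp add: cong_def)
      then show ?thesis using ab by blast
    next
      case False
      then have "?z < s + 2 * t" using zS unfolding iff by auto
      then have "2 * s \<le> p - ?z" using p_eq by linarith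
      moreover have "p - ?z \<notin> ?S" using sym[of "p - ?z"] zS by auto
      ultimately obtain a b where ab: "a \<in> ?S" "b \<in> ?S" "a + b = p - ?z" using upper[of "p - ?z"] zb by auto
      have "(p - a) + (p - b) = ?z + p" using ab(3) by simp
      then have "[(p - a) + (p - b) = z] (mod p)" unfolding cong_def by (simp only: mod_add_self2 mod_mod_trivial)
      then show ?thesis using sym ab by blast
    qed
    then obtain a b where ab: "a \<in> ?S" "b \<in> ?S" "[a + b = z] (mod p)" by blast
    then have "[z - a = b] (mod p)" by (simp add: cong_iff_dvd_diff dvd_diff_commute algebra_simps)
    then have "z - a \<in> ?X" using in_range[OF ab(2)] ab(2) by (simp add: cong_def)
    then have "a + (z - a) \<in> ?X + ?X" by (rule set_plus_intro[OF S_X[OF ab(1)]])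
    then show ?thesis by simp
  qed
  have "?X \<inter> {0..<p} = ?S" using in_range by force
  then have "\<mu> ?X = s" unfolding \<mu>_def using card_S_set[OF sub] cardT by simp
  moreover have "periodic ?X" by (rule periodicI) (simp add: cong_def)
  ultimately show ?thesis unfolding sym_complete_sum_free_def using neg sf complete by blast
qed

end

section \<open>The classification in the residue ring\<close>

context prime_modulus begin

lemma dilation_residue_ring:
  assumes A: "A \<subseteq> {0..<p}" and e: "[d * e = 1] (mod p)"
  shows "dilation (residue_ring p) d A = {y \<in> {0..<p}. (e * y) mod p \<in> A}"
proof -
  interpret R: residues p "residue_ring p" by unfold_locales (rule p_gt_1)
  have inv: "(e * ((d * a) mod p)) mod p = a mod p" "(d * ((e * a) mod p)) mod p = a mod p" for a
  proof -
    have "[(d * e) * a = 1 * a] (mod p)" using e by (intro cong_mult) auto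
    then show "(e * ((d * a) mod p)) mod p = a mod p" "(d * ((e * a) mod p)) mod p = a mod p"
      by (simp_all add: cong_def mod_mult_right_eq ac_simps)
  qed
  show ?thesis
  proof (intro equalityI subsetI)
    fix y assume "y \<in> dilation (residue_ring p) d A"
    then obtain a where a: "a \<in> A" "y = (d * a) mod p" unfolding dilation_def R.res_mult_eq by blast
    then have "(e * y) mod p = a" using inv(1)[of a] A by auto
    then show "y \<in> {y \<in> {0..<p}. (e * y) mod p \<in> A}" using a p_gt_1 by simp
  next
    fix y assume "y \<in> {y \<in> {0..<p}. (e * y) mod p \<in> A}"
    then have y: "y \<in> {0..<p}" "(e * y) mod p \<in> A" by auto
    then have "y = (d * ((e * y) mod p)) mod p" using inv(2)[of y] by simp
    then show "y \<in> dilation (residue_ring p) d A" using y(2) unfolding dilation_def R.res_mult_eq by blast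
  qed
qed

lemma sym_complete_sum_free_iff:
  assumes S: "S \<subseteq> {0..<p}"
  shows "symmetric_set (residue_ring p) S \<and> complete_set (residue_ring p) S
      \<and> sum_free (residue_ring p) S \<and> int (card S) = s
    \<longleftrightarrow> sym_complete_sum_free s {x. x mod p \<in> S}"
proof -
  interpret R: residues p "residue_ring p" by unfold_locales (rule p_gt_1)
  let ?X = "{x. x mod p \<in> S}"
  have small: "x mod p = x" if "x \<in> S" for x using that S by auto
  have S_X: "x \<in> ?X" if "x \<in> S" for x using that small by simp
  have per: "periodic ?X" by (rule periodicI) (simp add: cong_def)
  have add: "S <+>\<^bsub>residue_ring p\<^esub> S = {(a + b) mod p |a b. a \<in> S \<and> b \<in> S}"
    unfolding set_add_def' R.res_add_eq by blast
  have inv: "a_set_inv\<^bsub>residue_ring p\<^esub> S = (\<lambda>x. (- x) mod p) ` S"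
    unfolding A_SET_INV_def' R.res_neg_eq by blast
  have plus: "z mod p \<in> S <+>\<^bsub>residue_ring p\<^esub> S \<longleftrightarrow> z \<in> ?X + ?X" for z
  proof
    assume "z mod p \<in> S <+>\<^bsub>residue_ring p\<^esub> S"
    then obtain a b where ab: "a \<in> S" "b \<in> S" "z mod p = (a + b) mod p" unfolding add by blast
    have "(z - a) mod p = (z mod p - a) mod p" by (simp add: mod_diff_left_eq)
    also have "\<dots> = b mod p" unfolding ab(3) by (simp add: mod_diff_left_eq)
    finally have "z - a \<in> ?X" using ab small by simp
    then have "a + (z - a) \<in> ?X + ?X" using S_X[OF ab(1)] by (intro set_plus_intro)
    then show "z \<in> ?X + ?X" by simp
  next
    assume "z \<in> ?X + ?X"
    then obtain a b where ab: "a mod p \<in> S" "b mod p \<in> S" "z = a + b" by (auto elim: set_plus_elim)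
    then have "z mod p = (a mod p + b mod p) mod p" by (simp add: mod_add_eq)
    then show "z mod p \<in> S <+>\<^bsub>residue_ring p\<^esub> S" using ab unfolding add by blast
  qed
  have "symmetric_set (residue_ring p) S \<longleftrightarrow> (\<forall>x\<in>?X. - x \<in> ?X)"
  proof
    assume sym: "symmetric_set (residue_ring p) S"
    show "\<forall>x\<in>?X. - x \<in> ?X"
    proof
      fix x assume "x \<in> ?X"
      then have "(- (x mod p)) mod p \<in> S" using sym unfolding symmetric_set_def inv by blast
      then show "- x \<in> ?X" by (simp add: mod_minus_eq)
    qed
  next
    assume sym: "\<forall>x\<in>?X. - x \<in> ?X"
    have neg: "(- x) mod p \<in> S" if "x \<in> S" for x using sym S_X[OF that] by blast
    have "x \<in> (\<lambda>x. (- x) mod p) ` S" if "x \<in> S" for x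
    proof -
      have "(- ((- x) mod p)) mod p = x" using small[OF that] by (simp add: mod_minus_eq)
      then show ?thesis using neg[OF that] by (metis image_eqI)
    qed
    then show "symmetric_set (residue_ring p) S" unfolding symmetric_set_def inv using neg by blast
  qed
  moreover have "complete_set (residue_ring p) S \<longleftrightarrow> (\<forall>z. z \<notin> ?X \<longrightarrow> z \<in> ?X + ?X)"
  proof
    assume c: "complete_set (residue_ring p) S"
    show "\<forall>z. z \<notin> ?X \<longrightarrow> z \<in> ?X + ?X"
    proof (intro allI impI)
      fix z assume "z \<notin> ?X"
      then have "z mod p \<in> carrier (residue_ring p) - S" by simp
      then show "z \<in> ?X + ?X" using c plus unfolding complete_set_def by blast
    qed
  next
    assume c: "\<forall>z. z \<notin> ?X \<longrightarrow> z \<in> ?X + ?X"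
    show "complete_set (residue_ring p) S" unfolding complete_set_def
    proof
      fix z assume z: "z \<in> carrier (residue_ring p) - S"
      then have "z mod p = z" unfolding R.res_carrier_eq by simp
      then show "z \<in> S <+>\<^bsub>residue_ring p\<^esub> S" using c plus[of z] z by simp
    qed
  qed
  moreover have "sum_free (residue_ring p) S \<longleftrightarrow> (\<forall>a\<in>?X. \<forall>b\<in>?X. a + b \<notin> ?X)"
  proof
    assume sf: "sum_free (residue_ring p) S"
    show "\<forall>a\<in>?X. \<forall>b\<in>?X. a + b \<notin> ?X"
      using sf plus set_plus_intro[of _ ?X _ ?X] unfolding sum_free_def by blast
  next
    assume sf: "\<forall>a\<in>?X. \<forall>b\<in>?X. a + b \<notin> ?X"
    have "False" if ab: "a \<in> S" "b \<in> S" "(a + b) mod p \<in> S" for a b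
      using sf S_X[OF ab(1)] S_X[OF ab(2)] ab(3) by blast
    then show "sum_free (residue_ring p) S" unfolding sum_free_def add by blast
  qed
  moreover have "?X \<inter> {0..<p} = S" using S small by auto
  then have "int (card S) = s \<longleftrightarrow> \<mu> ?X = s" unfolding \<mu>_def by simp
  ultimately show ?thesis unfolding sym_complete_sum_free_def using per by blast
qed

end

context special_modulus begin

lemma classification:
  assumes t_small: "10^21 * t \<le> p"
  shows "{S. S \<subseteq> carrier (residue_ring p) \<and> symmetric_set (residue_ring p) S \<and>
           complete_set (residue_ring p) S \<and> sum_free (residue_ring p) S \<and> int (card S) = s}
       = {dilation (residue_ring p) d (S_set p s T) | d T.
           d \<in> carrier (residue_ring p) - {\<zero>\<^bsub>residue_ring p\<^esub>} \<and> special t T}"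
proof (intro equalityI subsetI)
  interpret R: residues p "residue_ring p" by unfold_locales (rule p_gt_1)
  have carrier: "carrier (residue_ring p) = {0..<p}" unfolding R.res_carrier_eq by auto
  {
    fix S assume "S \<in> {S. S \<subseteq> carrier (residue_ring p) \<and> symmetric_set (residue_ring p) S \<and>
           complete_set (residue_ring p) S \<and> sum_free (residue_ring p) S \<and> int (card S) = s}"
    then have S: "S \<subseteq> {0..<p}" and "sym_complete_sum_free s {x. x mod p \<in> S}"
      using sym_complete_sum_free_iff unfolding carrier by blast+
    let ?X = "{x. x mod p \<in> S}"
    note X = \<open>sym_complete_sum_free s ?X\<close>
    then have per: "periodic ?X" and sf: "\<And>a b. a \<in> ?X \<Longrightarrow> b \<in> ?X \<Longrightarrow> a + b \<notin> ?X" and mu: "\<mu> ?X = s"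
      unfolding sym_complete_sum_free_def by blast+
    obtain e where e: "\<not> p dvd e" "\<And>y. 4 * \<bar>y\<bar> \<le> p \<Longrightarrow> e * y \<notin> ?X"
      using exists_dilation_avoiding_middle[OF per sf t_pos _ t_small] p_eq unfolding mu by blast
    let ?Y = "{y. e * y \<in> ?X}"
    have Y: "sym_complete_sum_free s ?Y" by (rule sym_complete_sum_free_dilate[OF X e(1)])
    have "s \<le> y \<and> y \<le> p - s" if "y \<in> ?Y" "0 \<le> y" "y < p" for y
      using sum_free_subset_interval[OF Y _ _ that] e(2) t_pos s_ge by auto
    then obtain T where T: "special t T" "?Y \<inter> {0..<p} = S_set p s T"
      using subset_interval_imp_S_set[OF Y] by blast
    obtain e' where e': "[e * e' = 1] (mod p)" using inverse_mod_p[OF e(1)] by blast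
    then have de: "[(e mod p) * e' = 1] (mod p)" by (simp add: cong_def mod_mult_left_eq)
    have "dilation (residue_ring p) (e mod p) (S_set p s T) = {y \<in> {0..<p}. (e' * y) mod p \<in> ?Y \<inter> {0..<p}}"
      using dilation_residue_ring[OF _ de, of "?Y \<inter> {0..<p}"] T(2) by auto
    also have "\<dots> = S"
    proof -
      have "(e * ((e' * y) mod p)) mod p = y mod p" for y
      proof -
        have "[(e * e') * y = 1 * y] (mod p)" using e' by (intro cong_mult) auto
        then show ?thesis by (simp add: cong_def mod_mult_right_eq ac_simps)
      qed
      then show ?thesis using S p_gt_1 by auto
    qed
    finally have "S = dilation (residue_ring p) (e mod p) (S_set p s T)" ..
    moreover have "e mod p \<in> carrier (residue_ring p) - {\<zero>\<^bsub>residue_ring p\<^esub>}"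
      using e(1) p_gt_1 unfolding carrier R.res_zero_eq by (auto simp: dvd_eq_mod_eq_0)
    ultimately show "S \<in> {dilation (residue_ring p) d (S_set p s T) | d T.
           d \<in> carrier (residue_ring p) - {\<zero>\<^bsub>residue_ring p\<^esub>} \<and> special t T}" using T(1) by blast
  }
  {
    fix S assume "S \<in> {dilation (residue_ring p) d (S_set p s T) | d T.
           d \<in> carrier (residue_ring p) - {\<zero>\<^bsub>residue_ring p\<^esub>} \<and> special t T}"
    then obtain d T where dT: "S = dilation (residue_ring p) d (S_set p s T)" "d \<in> {1..<p}" "special t T"
      unfolding carrier R.res_zero_eq by force
    have sub: "T \<subseteq> {0..2 * t - 1}" using dT(3) unfolding special_def by blast
    have A: "S_set p s T \<subseteq> {0..<p}" using S_set_bounds[OF sub] t_pos s_ge by fastforce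
    have "\<not> p dvd d" using dT(2) by (simp add: zdvd_not_zless)
    then obtain e where e: "[d * e = 1] (mod p)" "\<not> p dvd e" using inverse_mod_p by blast
    have S: "S = {y \<in> {0..<p}. (e * y) mod p \<in> S_set p s T}"
      unfolding dT(1) by (rule dilation_residue_ring[OF A e(1)])
    have "sym_complete_sum_free s {y. e * y \<in> {x. x mod p \<in> S_set p s T}}"
      by (rule sym_complete_sum_free_dilate[OF sym_complete_sum_free_S_set[OF dT(3)] e(2)])
    also have "{y. e * y \<in> {x. x mod p \<in> S_set p s T}} = {y. y mod p \<in> S}"
      unfolding S using p_gt_1 by (simp add: mod_mult_right_eq)
    finally show "S \<in> {S. S \<subseteq> carrier (residue_ring p) \<and> symmetric_set (residue_ring p) S \<and>
           complete_set (residue_ring p) S \<and> sum_free (residue_ring p) S \<and> int (card S) = s}"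
      using sym_complete_sum_free_iff[of S s] S unfolding carrier by blast
  }
qed

end

theorem theorem3p8:
  shows "\<exists>c::real. c > 0 \<and> (\<exists>p0::nat. \<forall>p::nat. p \<ge> p0 \<longrightarrow> prime p \<longrightarrow>
    (\<forall>s t::int. of_int t = (of_nat p - 3 * of_int s + 1) / (2::real) \<longrightarrow> t > 0 \<longrightarrow>
       of_int t \<le> c * of_nat p \<longrightarrow>
       {S. S \<subseteq> carrier (residue_ring (int p)) \<and>
           symmetric_set (residue_ring (int p)) S \<and>
           complete_set (residue_ring (int p)) S \<and>
           sum_free (residue_ring (int p)) S \<and>
           int (card S) = s}
       = {dilation (residue_ring (int p)) d (S_set (int p) s T) | d T.
           d \<in> carrier (residue_ring (int p)) - {\<zero>\<^bsub>residue_ring (int p)\<^esub>} \<and> special t T}))"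
proof (intro exI[of _ "1 / 10^21 :: real"] conjI exI[of _ "0 :: nat"] allI impI)
  show "(1 / 10^21 :: real) > 0" by simp
  fix p :: nat and s t :: int
  assume p: "prime p" and t: "of_int t = (of_nat p - 3 * of_int s + 1) / (2::real)" "t > 0"
    "of_int t \<le> 1 / 10^21 * (of_nat p :: real)"
  have "(of_int (int p) :: real) = of_int (3 * s + 2 * t - 1)" using t(1) by simp
  then have p_eq: "int p = 3 * s + 2 * t - 1" by (simp only: of_int_eq_iff)
  have "(of_int (10^21 * t) :: real) \<le> of_int (int p)" using t(3) by (simp add: field_simps)
  then have t_small: "10^21 * t \<le> int p" by (simp only: of_int_le_iff)
  interpret special_modulus "int p" s t
  proof
    show "int p > 1" using prime_gt_1_nat[OF p] by simp
    show "prime (int p)" using p by simp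
    show "int p = 3 * s + 2 * t - 1" by (rule p_eq)
    show "1 \<le> t" using t(2) by simp
    show "4 * t \<le> s" using t(2) t_small p_eq by simp
  qed
  show "{S. S \<subseteq> carrier (residue_ring (int p)) \<and>
           symmetric_set (residue_ring (int p)) S \<and>
           complete_set (residue_ring (int p)) S \<and>
           sum_free (residue_ring (int p)) S \<and>
           int (card S) = s}
       = {dilation (residue_ring (int p)) d (S_set (int p) s T) | d T.
           d \<in> carrier (residue_ring (int p)) - {\<zero>\<^bsub>residue_ring (int p)\<^esub>} \<and> special t T}"
    by (rule classification[OF t_small])
qed

end
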